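(* Consider the AIRPF algorithm described in the context, with parameters $S_m\in\mathbb{N}_0$, $m=2^{S_m}$, $M\in\mathbb{N}$, $N=mM$ and threshold $\tau\in(0,1]$. Let $\mathcal{F}_n:=\sigma(\boldsymbol{\xi}_{0,0},\ldots,\boldsymbol{\xi}_{n,0})$, where $\boldsymbol{\xi}_{p,s}:=(\boldsymbol{\xi}^1_{p,s},\ldots,\boldsymbol{\xi}^m_{p,s})$. Then for all $n\in\mathbb{N}_0$ and all $\varphi\in\mathcal{B}(\mathbb{X})$, $$\mathbb{E}\big[\pi^N_{n+1}(\varphi)\,\big|\,\mathcal{F}_n\big]=\frac{\pi^N_n\big(g_nK_{n+1}(\varphi)\big)}{\pi^N_n(g_n)}.$$
   Context: $(\mathbb{X},\mathcal{X})$ is a measurable space and $\mathcal{B}(\mathbb{X})$ is the set of bounded measurable real functions on $\mathbb{X}$. For a kernel $L$ and a function $f$, $L(f)(x)=\int f(y)L(x,\mathrm{d}y)$. The model consists of a probability measure $\pi_0$ on $\mathbb{X}$, Markov kernels $K_n$ on $\mathbb{X}$ ($n\ge 1$) and non-negative bounded measurable potential functions $g_n$ on $\mathbb{X}$ ($n\ge 0$); $g_nK_{n+1}(\varphi)$ denotes the function $x\mapsto g_n(x)K_{n+1}(\varphi)(x)$. AIRPF: for $s\in\{1,\ldots,S_m\}$ let $A_s=\mathbf{I}_{2^{S_m-s}}\otimes\tfrac12\mathbf{1}_2\otimes\mathbf{I}_{2^{s-1}}$ (an $m\times m$ matrix; $\otimes$ is the Kronecker product, $\mathbf{I}_\ell$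 the $\ell\times\ell$ identity, $\mathbf{1}_2$ the $2\times 2$ matrix of ones). For each time $n\in\mathbb{N}_0$ and stage $s\in\{0,\ldots,S_m\}$ there are $m$ filters $k=1,\ldots,m$, each with a particle block $\boldsymbol{\xi}^k_{n,s}=(\xi^{k,1}_{n,s},\ldots,\xi^{k,M}_{n,s})\in\mathbb{X}^M$ and a filter weight $W^k_{n,s}\ge 0$, generated as follows. (i) $W^k_{0,0}=1$ and $\boldsymbol{\xi}^k_{0,0}$, $k=1,\ldots,m$, are i.i.d. with law $\pi_0^{\otimes M}$. (ii) Internal resampling: $W^k_{n,1}=W^k_{n,0}\frac1M\sum_{i=1}^M g_n(\xi^{k,i}_{n,0})$ and, conditionally on the past and independently over $k,i$, $\xi^{k,i}_{n,1}$ is drawn from $\sum_{j=1}^M g_n(\xi^{k,j}_{n,0})\delta_{\xi^{k,j}_{n,0}}/\sum_{j=1}^M g_n(\xi^{k,j}_{n,0})$. (iii) For $s=1,\ldots,S_m$: the effective number of filters is $\mathcal{E}^{mM}_{n,s}=(m^{-1}\sum_kW^k_{n,s})^2/(m^{-1}\sum_k(W^k_{n,s})^2)$; set $\alpha_s=A_s$ if $\mathcal{E}^{mM}_{n,s}<\tau$ and $\alpha_s=\mathbf{I}_m$ otherwise; $W^k_{n,s+1}=\sum_{\ell=1}^m\alpha_s^{k\ell}W^\ell_{n,s}$; conditionally on the past and independently over $k$, an index $L_k$ is drawn with $\mathbb{P}(L_k=\ell)=\alpha_s^{k\ell}W^\ell_{n,s}/W^k_{n,s+1}$; if $s<S_m$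 then $\boldsymbol{\xi}^k_{n,s+1}=\boldsymbol{\xi}^{L_k}_{n,s}$; if $s=S_m$ then $W^k_{n+1,0}=W^k_{n,S_m+1}$ and $\boldsymbol{\xi}^k_{n+1,0}$ is drawn from $K_{n+1}^{\otimes M}(\boldsymbol{\xi}^{L_k}_{n,S_m},\cdot)=K_{n+1}(\xi^{L_k,1}_{n,S_m},\cdot)\otimes\cdots\otimes K_{n+1}(\xi^{L_k,M}_{n,S_m},\cdot)$. (When $S_m=0$, $W_{n+1,0}=W_{n,1}$ and $\boldsymbol{\xi}_{n+1,0}\sim K^{\otimes M}_{n+1}(\boldsymbol{\xi}_{n,1},\cdot)$.) Output: $\pi^N_{n,s}=\dfrac{\sum_{k=1}^mW^k_{n,s}\frac1M\sum_{i=1}^M\delta_{\xi^{k,i}_{n,s}}}{\sum_{k=1}^mW^k_{n,s}}$ and $\pi^N_n=\pi^N_{n,0}$. *)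

theory Defs
  imports "HOL-Probability.Probability"
begin

text \<open>Particle configurations: xi k i is particle i of filter k (0-based, k < m, i < M).\<close>
type_synonym 'a cfg = "nat \<Rightarrow> nat \<Rightarrow> 'a"

definition block_space :: "nat \<Rightarrow> 'a measure \<Rightarrow> (nat \<Rightarrow> 'a) measure" where
  "block_space M X = PiM {..<M} (\<lambda>i. X)"

definition cfg_space :: "nat \<Rightarrow> nat \<Rightarrow> 'a measure \<Rightarrow> 'a cfg measure" where
  "cfg_space m M X = PiM {..<m} (\<lambda>k. block_space M X)"

text \<open>Matrices as functions nat => nat => real (0-based entries).
  kron r c A B is the Kronecker product of A with the r x c matrix B.\<close>
definition kron :: "nat \<Rightarrow> nat \<Rightarrow> (nat \<Rightarrow> nat \<Rightarrow> real) \<Rightarrow> (nat \<Rightarrow> nat \<Rightarrow> real) \<Rightarrow> (nat \<Rightarrow> nat \<Rightarrow> real)" where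
  "kron r c A B = (\<lambda>i j. A (i div r) (j div c) * B (i mod r) (j mod c))"

definition idm :: "nat \<Rightarrow> nat \<Rightarrow> real" where
  "idm = (\<lambda>i j. if i = j then 1 else 0)"

text \<open>A_s = I_(2^(Sm-s)) (x) (1/2) 1_2 (x) I_(2^(s-1)).\<close>
definition A_mat :: "nat \<Rightarrow> nat \<Rightarrow> nat \<Rightarrow> real" where
  "A_mat s = kron (2^(s-1)) (2^(s-1)) (kron 2 2 idm (\<lambda>_ _. 1/2)) idm"

definition eff_filters :: "nat \<Rightarrow> (nat \<Rightarrow> real) \<Rightarrow> real" where
  "eff_filters m W = ((1/m) * (\<Sum>k<m. W k))^2 / ((1/m) * (\<Sum>k<m. (W k)^2))"

definition alpha_mat :: "nat \<Rightarrow> real \<Rightarrow> nat \<Rightarrow> (nat \<Rightarrow> real) \<Rightarrow> nat \<Rightarrow> nat \<Rightarrow> real" where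
  "alpha_mat m \<tau> s W = (if eff_filters m W < \<tau> then A_mat s else idm)"

definition sel_W :: "nat \<Rightarrow> (nat \<Rightarrow> nat \<Rightarrow> real) \<Rightarrow> (nat \<Rightarrow> real) \<Rightarrow> nat \<Rightarrow> real" where
  "sel_W m \<alpha> W = (\<lambda>k. \<Sum>l<m. \<alpha> k l * W l)"

text \<open>Law of the selected index L_k (convention: L_k = k if W_{n,s+1}^k = 0).\<close>
definition L_dist :: "nat \<Rightarrow> (nat \<Rightarrow> nat \<Rightarrow> real) \<Rightarrow> (nat \<Rightarrow> real) \<Rightarrow> nat \<Rightarrow> nat measure" where
  "L_dist m \<alpha> W k =
     (if sel_W m \<alpha> W k = 0 then return (count_space {..<m}) k
      else density (count_space {..<m}) (\<lambda>l. ennreal (\<alpha> k l * W l / sel_W m \<alpha> W k)))"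

definition sel_stage :: "nat \<Rightarrow> nat \<Rightarrow> 'a measure \<Rightarrow> (nat \<Rightarrow> nat \<Rightarrow> real) \<Rightarrow> (nat \<Rightarrow> real)
    \<Rightarrow> 'a cfg \<Rightarrow> 'a cfg measure" where
  "sel_stage m M X \<alpha> W xi =
     PiM {..<m} (\<lambda>k. distr (L_dist m \<alpha> W k) (block_space M X) (\<lambda>l. xi l))"

text \<open>Internal resampling of particle i in block b
  (convention: keep the particle if all potentials in the block vanish).\<close>
definition resamp_dist :: "nat \<Rightarrow> 'a measure \<Rightarrow> ('a \<Rightarrow> real) \<Rightarrow> (nat \<Rightarrow> 'a) \<Rightarrow> nat \<Rightarrow> 'a measure" where
  "resamp_dist M X gn b i =
     (if (\<Sum>j<M. gn (b j)) = 0 then return X (b i)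
      else distr (density (count_space {..<M}) (\<lambda>j. ennreal (gn (b j) / (\<Sum>j'<M. gn (b j')))))
                 X b)"

definition resamp_stage :: "nat \<Rightarrow> nat \<Rightarrow> 'a measure \<Rightarrow> ('a \<Rightarrow> real) \<Rightarrow> 'a cfg \<Rightarrow> 'a cfg measure" where
  "resamp_stage m M X gn xi = PiM {..<m} (\<lambda>k. PiM {..<M} (\<lambda>i. resamp_dist M X gn (xi k) i))"

definition mut_stage :: "nat \<Rightarrow> nat \<Rightarrow> ('a \<Rightarrow> 'a measure) \<Rightarrow> 'a cfg \<Rightarrow> 'a cfg measure" where
  "mut_stage m M Kn xi = PiM {..<m} (\<lambda>k. PiM {..<M} (\<lambda>i. Kn (xi k i)))"

definition W_res :: "nat \<Rightarrow> nat \<Rightarrow> ('a \<Rightarrow> real) \<Rightarrow> (nat \<Rightarrow> real) \<Rightarrow> 'a cfg \<Rightarrow> nat \<Rightarrow> real" where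
  "W_res m M gn W xi = (\<lambda>k. W k * ((1/M) * (\<Sum>i<M. gn (xi k i))))"

text \<open>W_stage m tau W1 j = W_{n,j+1}, given W1 = W_{n,1}.\<close>
fun W_stage :: "nat \<Rightarrow> real \<Rightarrow> (nat \<Rightarrow> real) \<Rightarrow> nat \<Rightarrow> nat \<Rightarrow> real" where
  "W_stage m \<tau> W1 0 = W1"
| "W_stage m \<tau> W1 (Suc j) =
     sel_W m (alpha_mat m \<tau> (Suc j) (W_stage m \<tau> W1 j)) (W_stage m \<tau> W1 j)"

text \<open>xi_chain ... j = law of xi_{n,j+1} given W_{n,0}, xi_{n,0}.\<close>
fun xi_chain :: "nat \<Rightarrow> nat \<Rightarrow> 'a measure \<Rightarrow> ('a \<Rightarrow> real) \<Rightarrow> real \<Rightarrow> (nat \<Rightarrow> real)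
    \<Rightarrow> 'a cfg \<Rightarrow> nat \<Rightarrow> 'a cfg measure" where
  "xi_chain m M X gn \<tau> W xi 0 = resamp_stage m M X gn xi"
| "xi_chain m M X gn \<tau> W xi (Suc j) =
     xi_chain m M X gn \<tau> W xi j \<bind>
       (\<lambda>xi'. sel_stage m M X (alpha_mat m \<tau> (Suc j) (W_stage m \<tau> (W_res m M gn W xi) j))
                 (W_stage m \<tau> (W_res m M gn W xi) j) xi')"

definition airpf_Wnext :: "('a \<Rightarrow> real) \<Rightarrow> nat \<Rightarrow> nat \<Rightarrow> real \<Rightarrow> nat \<Rightarrow> (nat \<Rightarrow> real) \<Rightarrow> 'a cfg \<Rightarrow> nat \<Rightarrow> real" where
  "airpf_Wnext gn Sm M \<tau> n W xi = W_stage (2^Sm) \<tau> (W_res (2^Sm) M gn W xi) Sm"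

definition airpf_step :: "'a measure \<Rightarrow> (nat \<Rightarrow> 'a \<Rightarrow> 'a measure) \<Rightarrow> (nat \<Rightarrow> 'a \<Rightarrow> real) \<Rightarrow> nat \<Rightarrow> nat \<Rightarrow> real
    \<Rightarrow> nat \<Rightarrow> (nat \<Rightarrow> real) \<Rightarrow> 'a cfg \<Rightarrow> 'a cfg measure" where
  "airpf_step X K g Sm M \<tau> n W xi =
     xi_chain (2^Sm) M X (g n) \<tau> W xi Sm \<bind> (\<lambda>xi'. mut_stage (2^Sm) M (K (Suc n)) xi')"

text \<open>Filter weights W_{n,0} as a (deterministic) function of the history h p = xi_{p,0}.\<close>
fun airpf_W :: "(nat \<Rightarrow> 'a \<Rightarrow> real) \<Rightarrow> nat \<Rightarrow> nat \<Rightarrow> real \<Rightarrow> nat \<Rightarrow> (nat \<Rightarrow> 'a cfg) \<Rightarrow> nat \<Rightarrow> real" where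
  "airpf_W g Sm M \<tau> 0 h = (\<lambda>k. 1)"
| "airpf_W g Sm M \<tau> (Suc n) h = airpf_Wnext (g n) Sm M \<tau> n (airpf_W g Sm M \<tau> n h) (h n)"

definition hist_space :: "'a measure \<Rightarrow> nat \<Rightarrow> nat \<Rightarrow> nat \<Rightarrow> (nat \<Rightarrow> 'a cfg) measure" where
  "hist_space X Sm M n = PiM {..n} (\<lambda>_. cfg_space (2^Sm) M X)"

fun airpf_hist :: "'a measure \<Rightarrow> 'a measure \<Rightarrow> (nat \<Rightarrow> 'a \<Rightarrow> 'a measure) \<Rightarrow> (nat \<Rightarrow> 'a \<Rightarrow> real)
    \<Rightarrow> nat \<Rightarrow> nat \<Rightarrow> real \<Rightarrow> nat \<Rightarrow> (nat \<Rightarrow> 'a cfg) measure" where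
  "airpf_hist X pi0 K g Sm M \<tau> 0 =
     distr (PiM {..<2^Sm} (\<lambda>k. PiM {..<M} (\<lambda>i. pi0))) (hist_space X Sm M 0) (\<lambda>c. \<lambda>p\<in>{..0}. c)"
| "airpf_hist X pi0 K g Sm M \<tau> (Suc n) =
     airpf_hist X pi0 K g Sm M \<tau> n \<bind>
       (\<lambda>h. distr (airpf_step X K g Sm M \<tau> n (airpf_W g Sm M \<tau> n h) (h n))
                  (hist_space X Sm M (Suc n)) (\<lambda>c. h(Suc n := c)))"

definition airpf_filt :: "'a measure \<Rightarrow> nat \<Rightarrow> nat \<Rightarrow> (nat \<Rightarrow> 'a cfg) measure \<Rightarrow> nat \<Rightarrow> (nat \<Rightarrow> 'a cfg) measure" where
  "airpf_filt X Sm M P n = vimage_algebra (space P) (\<lambda>h. restrict h {..n}) (hist_space X Sm M n)"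

definition piN :: "nat \<Rightarrow> nat \<Rightarrow> (nat \<Rightarrow> real) \<Rightarrow> 'a cfg \<Rightarrow> ('a \<Rightarrow> real) \<Rightarrow> real" where
  "piN m M W xi f = (\<Sum>k<m. W k * ((1/M) * (\<Sum>i<M. f (xi k i)))) / (\<Sum>k<m. W k)"

end

theory Submission
  imports Defs
begin

text \<open>
  The weights \<open>W\<close> at every stage are functions of the history, so only the particles are random given
  the past. The columns of each \<open>\<alpha>\<close>-matrix sum to one; hence a selection stage preserves the total
  weight, and also preserves the conditional mean of every sum \<open>\<Sum>k. W k * F (xi k)\<close> with \<open>F\<close> a bounded
  function of the block. Through all selection stages this mean is therefore the one produced by internal
  resampling, where the new weight cancels the normalising constant of the resampling
  distribution and, for \<open>F\<close> the block average of \<open>\<psi>\<close>, leaves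
  \<open>\<Sum>k. W k * (1/M) * (\<Sum>i. g (xi k i) * \<psi> (xi k i))\<close>. Mutation contributes \<open>\<psi> = K \<phi>\<close>. Dividing by the total weight, which is known given the past, gives
  the ratio in the theorem.
\<close>

section \<open>Finite products of kernels, discrete kernels and their integrals\<close>

lemma measurable_PiM_kernel:
  assumes I: "finite I" and \<kappa>: "\<And>i. i \<in> I \<Longrightarrow> \<kappa> i \<in> A \<rightarrow>\<^sub>M prob_algebra (N i)"
  shows "(\<lambda>a. PiM I (\<lambda>i. \<kappa> i a)) \<in> A \<rightarrow>\<^sub>M prob_algebra (PiM I N)"
\<comment> \<open>It suffices to test the Int-stable generator of rectangles, on which the product
  measure is a finite product of measurable kernel evaluations.\<close>
proof (rule measurable_prob_algebra_generated[OF sets_PiM Int_stable_prod_algebra prod_algebra_sets_into_space])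
  have sp: "sets (\<kappa> i a) = sets (N i)" "prob_space (\<kappa> i a)" if "i \<in> I" "a \<in> space A" for i a
    using measurable_space[OF \<kappa>, OF that] by (auto simp: space_prob_algebra)
  show "prob_space (PiM I (\<lambda>i. \<kappa> i a))" if "a \<in> space A" for a
    using that by (intro prob_space_PiM sp)
  show "sets (PiM I (\<lambda>i. \<kappa> i a)) = sets (PiM I N)" if "a \<in> space A" for a
    using that by (intro sets_PiM_cong sp refl)
  fix B assume "B \<in> prod_algebra I N"
  then obtain E where B: "B = Pi\<^sub>E I E" and E: "\<And>i. i \<in> I \<Longrightarrow> E i \<in> sets (N i)"
    unfolding prod_algebra_eq_finite[OF I] by auto
  have "emeasure (PiM I (\<lambda>i. \<kappa> i a)) B = (\<Prod>i\<in>I. emeasure (\<kappa> i a) (E i))" if a: "a \<in> space A" for a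
  proof -
    have "B = prod_emb I (\<lambda>i. \<kappa> i a) I (Pi\<^sub>E I E)"
      unfolding B using E sp(1)[OF _ a]
      by (intro prod_emb_PiE_same_index[symmetric]) (blast dest: sets.sets_into_space)
    then show ?thesis
      using E sp[OF _ a] I by (simp add: emeasure_PiM_emb)
  qed
  moreover have "(\<lambda>a. \<Prod>i\<in>I. emeasure (\<kappa> i a) (E i)) \<in> borel_measurable A"
    using E by (intro borel_measurable_prod_ennreal measurable_emeasure_kernel[OF measurable_prob_algebraD[OF \<kappa>]])
  ultimately show "(\<lambda>a. emeasure (PiM I (\<lambda>i. \<kappa> i a)) B) \<in> borel_measurable A"
    by (simp cong: measurable_cong)
qed

text \<open>The index set is finite, so the mass of any subset is a finite sum of measurable
  weights.\<close>

lemma measurable_density_count_space: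
  fixes w :: "'b \<Rightarrow> 'c \<Rightarrow> real"
  assumes I: "finite I" and w[measurable]: "\<And>j. j \<in> I \<Longrightarrow> (\<lambda>a. w a j) \<in> borel_measurable A"
    and nn: "\<And>a j. a \<in> space A \<Longrightarrow> j \<in> I \<Longrightarrow> 0 \<le> w a j"
    and one: "\<And>a. a \<in> space A \<Longrightarrow> (\<Sum>j\<in>I. w a j) = 1"
  shows "(\<lambda>a. density (count_space I) (\<lambda>j. ennreal (w a j))) \<in> A \<rightarrow>\<^sub>M prob_algebra (count_space I)"
proof -
  have eq: "emeasure (density (count_space I) (\<lambda>j. ennreal (w a j))) B = (\<Sum>j\<in>B. ennreal (w a j))"
    if "B \<subseteq> I" for a B
  proof -
    have "emeasure (density (count_space I) (\<lambda>j. ennreal (w a j))) B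
      = (\<Sum>j\<in>I. ennreal (w a j) * indicator B j)"
      using that I by (simp add: emeasure_density nn_integral_count_space_finite)
    also have "\<dots> = (\<Sum>j\<in>B. ennreal (w a j))"
      using that I by (intro sum.mono_neutral_cong_right) (auto simp: indicator_def)
    finally show ?thesis .
  qed
  show ?thesis
  proof (intro measurable_prob_algebraI measurable_subprob_algebra)
    show p: "prob_space (density (count_space I) (\<lambda>j. ennreal (w a j)))" if "a \<in> space A" for a
      by (rule prob_spaceI) (simp add: eq sum_ennreal nn[OF that] one[OF that])
    show "subprob_space (density (count_space I) (\<lambda>j. ennreal (w a j)))" if "a \<in> space A" for a
      by (intro prob_space_imp_subprob_space p that)
    show "(\<lambda>a. emeasure (density (count_space I) (\<lambda>j. ennreal (w a j))) B) \<in> borel_measurable A"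
      if "B \<in> sets (count_space I)" for B
      using that by (auto simp: eq intro!: borel_measurable_sum measurable_compose[OF w])
  qed simp
qed

lemma integral_density_count_space:
  fixes w f :: "'c \<Rightarrow> real"
  assumes "finite I" "\<And>j. j \<in> I \<Longrightarrow> 0 \<le> w j"
  shows "(\<integral>j. f j \<partial>density (count_space I) (\<lambda>j. ennreal (w j))) = (\<Sum>j\<in>I. w j * f j)"
  using assms by (subst integral_density) (auto simp: lebesgue_integral_count_space_finite AE_count_space)

text \<open>This puts a point mass into the density form of the other discrete laws, so that the
  conventions for vanishing weights can be merged with the regular case.\<close>

lemma density_count_space_of_bool:
  assumes "finite I" "i \<in> I"
  shows "density (count_space I) (\<lambda>j. ennreal (of_bool (j = i))) = return (count_space I) i"
proof (rule measure_eqI)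
  fix B assume "B \<in> sets (density (count_space I) (\<lambda>j. ennreal (of_bool (j = i))))"
  then have B: "B \<subseteq> I" by simp
  have "(\<Sum>j\<in>I. ennreal (of_bool (j = i)) * indicator B j) = (\<Sum>j\<in>I. if j = i then indicator B i else 0)"
    by (intro sum.cong) auto
  then show "emeasure (density (count_space I) (\<lambda>j. ennreal (of_bool (j = i)))) B
      = emeasure (return (count_space I) i) B"
    using assms B by (simp add: emeasure_density nn_integral_count_space_finite)
qed simp

lemma measurable_distr_density_count_space:
  fixes w :: "'b \<Rightarrow> 'c \<Rightarrow> real"
  assumes I: "finite I" and w: "\<And>j. j \<in> I \<Longrightarrow> (\<lambda>a. w a j) \<in> borel_measurable A"
    and nn: "\<And>a j. a \<in> space A \<Longrightarrow> j \<in> I \<Longrightarrow> 0 \<le> w a j"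
    and one: "\<And>a. a \<in> space A \<Longrightarrow> (\<Sum>j\<in>I. w a j) = 1"
    and x: "\<And>j. j \<in> I \<Longrightarrow> (\<lambda>a. x a j) \<in> A \<rightarrow>\<^sub>M X"
  shows "(\<lambda>a. distr (density (count_space I) (\<lambda>j. ennreal (w a j))) X (x a)) \<in> A \<rightarrow>\<^sub>M prob_algebra X"
proof (rule measurable_distr_prob_space2[OF measurable_density_count_space[OF I w nn one]])
  \<comment> \<open>Joint measurability in parameter and index comes from gluing together the maps
    for the finitely many fixed indices.\<close>
  have "(\<lambda>p. x (fst p) (snd p)) \<in> A \<Otimes>\<^sub>M count_space I \<rightarrow>\<^sub>M X"
    by (rule measurable_compose_countable'[where f="\<lambda>j p. x (fst p) j" and g=snd and I=I])
       (auto intro: measurable_compose[OF measurable_fst x] countable_finite I)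
  then show "(\<lambda>(a, j). x a j) \<in> A \<Otimes>\<^sub>M count_space I \<rightarrow>\<^sub>M X"
    by (simp add: case_prod_unfold)
qed auto

lemma integral_distr_density_count_space:
  fixes w :: "'c \<Rightarrow> real" and f :: "'a \<Rightarrow> real"
  assumes "finite I" "\<And>j. j \<in> I \<Longrightarrow> 0 \<le> w j" "\<And>j. j \<in> I \<Longrightarrow> x j \<in> space X" "f \<in> borel_measurable X"
  shows "(\<integral>y. f y \<partial>distr (density (count_space I) (\<lambda>j. ennreal (w j))) X x) = (\<Sum>j\<in>I. w j * f (x j))"
  using assms by (subst integral_distr) (auto simp: integral_density_count_space)

lemma integral_PiM_component:
  fixes f :: "'b \<Rightarrow> real"
  assumes M: "\<And>i. i \<in> I \<Longrightarrow> prob_space (M i)" and i: "i \<in> I" and f: "f \<in> borel_measurable (M i)"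
  shows "(\<integral>\<omega>. f (\<omega> i) \<partial>PiM I M) = (\<integral>x. f x \<partial>M i)"
  using integral_distr[OF measurable_component_singleton[of i I M, OF i] f]
  by (simp add: distr_PiM_component[of I M i] M i)

text \<open>Boundedness of \<open>f\<close> stands in for an integrability condition, since every
  kernel measure has mass at most one.\<close>

lemma integral_bind_prob_algebra:
  fixes f :: "'b \<Rightarrow> real"
  assumes \<mu>: "\<mu> \<in> space (prob_algebra A)" and \<kappa>: "\<kappa> \<in> A \<rightarrow>\<^sub>M prob_algebra N"
    and f: "f \<in> borel_measurable N" and bdd: "\<And>x. x \<in> space N \<Longrightarrow> \<bar>f x\<bar> \<le> B"
  shows "(\<integral>x. f x \<partial>(\<mu> \<bind> \<kappa>)) = (\<integral>a. (\<integral>x. f x \<partial>\<kappa> a) \<partial>\<mu>)"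
proof -
  interpret prob_space \<mu> using \<mu> by (simp add: space_prob_algebra)
  have sets[measurable_cong]: "sets \<mu> = sets A" using \<mu> by (simp add: space_prob_algebra)
  have \<kappa>'[measurable]: "\<kappa> \<in> \<mu> \<rightarrow>\<^sub>M subprob_algebra N"
    using measurable_prob_algebraD[OF \<kappa>] by simp
  \<comment> \<open>A point is required because \<open>bind\<close> is the join of a pushforward
    only over a nonempty space.\<close>
  obtain a where a: "a \<in> space \<mu>" using not_empty by auto
  have "(\<integral>x. f x \<partial>(\<mu> \<bind> \<kappa>)) = (\<integral>x. f x \<partial>join (distr \<mu> (subprob_algebra N) \<kappa>))"
    by (simp add: bind_nonempty'[OF \<kappa>' a])
  also have "\<dots> = (\<integral>M'. (\<integral>x. f x \<partial>M') \<partial>distr \<mu> (subprob_algebra N) \<kappa>)"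
  proof (rule integral_join[OF f bdd, where B'=1])
    show "finite_measure (distr \<mu> (subprob_algebra N) \<kappa>)"
      by (rule finite_measure_distr) simp
    show "AE M' in distr \<mu> (subprob_algebra N) \<kappa>. emeasure M' (space M') \<le> ennreal 1"
      by (rule AE_I2) (auto simp: space_subprob_algebra subprob_space.emeasure_space_le_1)
  qed auto
  also have "\<dots> = (\<integral>a. (\<integral>x. f x \<partial>\<kappa> a) \<partial>\<mu>)"
    using f by (subst integral_distr) auto
  finally show ?thesis .
qed

lemma (in prob_space) abs_expectation_le:
  fixes f :: "'a \<Rightarrow> real"
  assumes "f \<in> borel_measurable M" "\<And>x. x \<in> space M \<Longrightarrow> \<bar>f x\<bar> \<le> B"
  shows "\<bar>expectation f\<bar> \<le> B"
proof -
  have i: "integrable M f"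
    using assms by (intro integrable_const_bound[of _ B]) auto
  have "\<bar>expectation f\<bar> \<le> expectation (\<lambda>x. \<bar>f x\<bar>)"
    by (rule integral_abs_bound)
  also have "\<dots> \<le> B"
    using integrable_abs[OF i] assms by (intro integral_le_const) auto
  finally show ?thesis .
qed

subsection \<open>The selection matrices\<close>

lemma A_mat_nonneg: "0 \<le> A_mat s k l"
  by (simp add: A_mat_def kron_def idm_def)

text \<open>\<open>A_mat s\<close> averages over pairs of indices that differ only in the binary
  digit of weight \<open>2^(s-1)\<close>. Column \<open>l\<close> therefore has exactly two nonzero
  entries, both 1/2, and \<open>s \<le> S\<close> keeps both row indices below
  \<open>2^S\<close>.\<close>

lemma A_mat_col_sum:
  assumes s: "1 \<le> s" "s \<le> S" and l: "l < 2 ^ S"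
  shows "(\<Sum>k<2^S. A_mat s k l) = 1"
proof -
  define q :: nat where "q = 2 ^ (s - 1)"
  have q: "q > 0" by (simp add: q_def)
  have "2 ^ S = (2::nat) ^ (s - 1) * 2 * 2 ^ (S - s)"
    using s by (simp flip: power_add power_Suc2)
  then obtain r where r: "2 ^ S = 2 * q * r" unfolding q_def by (metis mult.commute)
  \<comment> \<open>\<open>c\<close> is \<open>l\<close> with the digit of weight \<open>q\<close>
    cleared, so the two nonzero rows are \<open>c\<close> and \<open>c + q\<close>.\<close>
  define c where "c = 2 * q * (l div (2 * q)) + l mod q"
  \<comment> \<open>The index range splits into \<open>r\<close> full blocks of length
    \<open>2 * q\<close>; the block containing \<open>l\<close> contains \<open>c + q\<close> as
    well.\<close>
  have lq: "l div (2 * q) < r"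
    using l unfolding r by (simp add: less_mult_imp_div_less mult.commute)
  then have "2 * q * (l div (2 * q)) + 2 * q \<le> 2 * q * r"
    by (metis Suc_leI add.commute mult_Suc_right mult_le_mono2)
  then have cl: "c + q < 2 ^ S"
    unfolding c_def r using mod_less_divisor[OF q, of l] by linarith
  \<comment> \<open>The identity factors fix the digits above and below weight \<open>q\<close>; the
    constant middle factor leaves that digit free.\<close>
  have A: "A_mat s k l = (if k div (2 * q) = l div (2 * q) \<and> k mod q = l mod q then 1/2 else 0)" for k
    unfolding A_mat_def q_def[symmetric]
    by (auto simp: kron_def idm_def div_mult2_eq mult.commute[of 2])
  have *: "{k. k < 2 ^ S \<and> k div (2 * q) = l div (2 * q) \<and> k mod q = l mod q} = {c, c + q}" (is "?S = _")
  proof (intro equalityI subsetI)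
    fix k assume "k \<in> ?S"
    then have k: "k div (2 * q) = l div (2 * q)" "k mod q = l mod q" by auto
    have "k = q * (k div q) + k mod q" by simp
    also have "k div q = 2 * (k div q div 2) + k div q mod 2" by simp
    also have "k div q div 2 = l div (2 * q)" using k by (simp add: div_mult2_eq mult.commute[of 2])
    finally have "k = c + q * (k div q mod 2)"
      using k by (simp add: c_def algebra_simps)
    moreover have "k div q mod 2 = 0 \<or> k div q mod 2 = 1" by auto
    ultimately show "k \<in> {c, c + q}" by auto
  next
    have m: "l mod q < q" using q by simp
    have "c div (2 * q) = l div (2 * q)" "(c + q) div (2 * q) = l div (2 * q)"
      using m by (auto simp: c_def add.assoc div_mult_self4)
    moreover have "c mod q = l mod q" "(c + q) mod q = l mod q"
      using q by (auto simp: c_def mult.assoc mod_mult_self4 ac_simps)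
    moreover fix k assume "k \<in> {c, c + q}"
    ultimately show "k \<in> ?S" using cl by auto
  qed
  have "(\<Sum>k<2^S. A_mat s k l) = (\<Sum>k\<in>{c, c + q}. 1/2)"
    unfolding *[symmetric] A by (simp add: sum.If_cases Int_def lessThan_def conj_commute)
  then show ?thesis using q by simp
qed

lemma alpha_mat_nonneg: "0 \<le> alpha_mat m \<tau> s W k l"
  by (simp add: alpha_mat_def A_mat_nonneg idm_def)

lemma alpha_mat_col_sum:
  assumes "1 \<le> s" "s \<le> S" "l < 2 ^ S"
  shows "(\<Sum>k<2^S. alpha_mat (2^S) \<tau> s W k l) = 1"
  using A_mat_col_sum[OF assms] assms(3) by (simp add: alpha_mat_def idm_def)

subsection \<open>Measurability of the particle kernels\<close>

lemma measurable_block: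
  assumes "z \<in> A \<rightarrow>\<^sub>M cfg_space m M X" "k < m"
  shows "(\<lambda>a. z a k) \<in> A \<rightarrow>\<^sub>M block_space M X"
  using measurable_compose[OF assms(1)[unfolded cfg_space_def] measurable_component_singleton, of k] assms(2)
  by simp

lemma measurable_particle:
  assumes "z \<in> A \<rightarrow>\<^sub>M cfg_space m M X" "k < m" "i < M"
  shows "(\<lambda>a. z a k i) \<in> A \<rightarrow>\<^sub>M X"
  using measurable_compose[OF measurable_block[OF assms(1,2), unfolded block_space_def]
      measurable_component_singleton, of i] assms(3) by simp

lemma block_in_space: "xi \<in> space (cfg_space m M X) \<Longrightarrow> k < m \<Longrightarrow> xi k \<in> space (block_space M X)"
  by (auto simp: cfg_space_def space_PiM)

lemma particle_in_space: "b \<in> space (block_space M X) \<Longrightarrow> i < M \<Longrightarrow> b i \<in> space X"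
  by (auto simp: block_space_def space_PiM)

text \<open>Both conventions for vanishing weights are point masses, so they are absorbed here into the weights;
  each discrete law then is a single density and no measurable case split on laws is needed.\<close>

definition resamp_weight :: "nat \<Rightarrow> ('a \<Rightarrow> real) \<Rightarrow> (nat \<Rightarrow> 'a) \<Rightarrow> nat \<Rightarrow> nat \<Rightarrow> real" where
  "resamp_weight M gn b i j =
     (if (\<Sum>j<M. gn (b j)) = 0 then of_bool (j = i) else gn (b j) / (\<Sum>j'<M. gn (b j')))"

definition sel_weight :: "nat \<Rightarrow> (nat \<Rightarrow> nat \<Rightarrow> real) \<Rightarrow> (nat \<Rightarrow> real) \<Rightarrow> nat \<Rightarrow> nat \<Rightarrow> real" where
  "sel_weight m \<alpha> W k l =
     (if sel_W m \<alpha> W k = 0 then of_bool (l = k) else \<alpha> k l * W l / sel_W m \<alpha> W k)"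

lemma resamp_dist_eq:
  assumes "i < M" "b \<in> space (block_space M X)"
  shows "resamp_dist M X gn b i
    = distr (density (count_space {..<M}) (\<lambda>j. ennreal (resamp_weight M gn b i j))) X b"
proof (cases "(\<Sum>j<M. gn (b j)) = 0")
  case True
  have "distr (return (count_space {..<M}) i) X b = return X (b i)"
    using assms by (intro distr_return) (auto dest: particle_in_space)
  then show ?thesis
    using True density_count_space_of_bool[of "{..<M}" i] assms
    by (simp add: resamp_dist_def resamp_weight_def)
qed (simp add: resamp_dist_def resamp_weight_def)

lemma L_dist_eq:
  assumes "k < m"
  shows "L_dist m \<alpha> W k = density (count_space {..<m}) (\<lambda>l. ennreal (sel_weight m \<alpha> W k l))"
  using density_count_space_of_bool[of "{..<m}" k] assms
  by (simp add: L_dist_def sel_weight_def)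

lemma resamp_weight_nonneg: "(\<And>j. j < M \<Longrightarrow> 0 \<le> gn (b j)) \<Longrightarrow> j < M \<Longrightarrow> 0 \<le> resamp_weight M gn b i j"
  by (auto simp: resamp_weight_def intro!: divide_nonneg_nonneg sum_nonneg)

lemma resamp_weight_sum: "i < M \<Longrightarrow> (\<Sum>j<M. resamp_weight M gn b i j) = 1"
  by (cases "(\<Sum>j<M. gn (b j)) = 0") (simp_all add: resamp_weight_def of_bool_def flip: sum_divide_distrib)

text \<open>A division-free form that covers both cases: if the normaliser is 0, nonnegativity
  forces every potential in the block to be 0, so the convention chosen there does not affect the
  product.\<close>

lemma sum_mult_resamp_weight:
  assumes "\<And>j. j < M \<Longrightarrow> 0 \<le> gn (b j)" "j < M"
  shows "(\<Sum>j<M. gn (b j)) * resamp_weight M gn b i j = gn (b j)"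
proof (cases "(\<Sum>j<M. gn (b j)) = 0")
  case True
  then have "gn (b j) = 0" using assms by (subst (asm) sum_nonneg_eq_0_iff) auto
  with True show ?thesis by simp
qed (simp add: resamp_weight_def)

lemma sel_W_nonneg:
  "(\<And>l. l < m \<Longrightarrow> 0 \<le> \<alpha> k l) \<Longrightarrow> (\<And>l. l < m \<Longrightarrow> 0 \<le> W l) \<Longrightarrow> 0 \<le> sel_W m \<alpha> W k"
  by (auto simp: sel_W_def intro!: sum_nonneg)

lemma sel_weight_nonneg:
  "(\<And>l. l < m \<Longrightarrow> 0 \<le> \<alpha> k l) \<Longrightarrow> (\<And>l. l < m \<Longrightarrow> 0 \<le> W l) \<Longrightarrow> l < m \<Longrightarrow> 0 \<le> sel_weight m \<alpha> W k l"
  by (auto simp: sel_weight_def intro!: divide_nonneg_nonneg sel_W_nonneg)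

lemma sel_weight_sum: "k < m \<Longrightarrow> (\<Sum>l<m. sel_weight m \<alpha> W k l) = 1"
  by (cases "sel_W m \<alpha> W k = 0") (simp_all add: sel_weight_def of_bool_def flip: sum_divide_distrib, simp add: sel_W_def)

text \<open>As for resampling, a vanishing new weight forces every term
  \<open>\<alpha> k l * W l\<close> to vanish, so the identity survives the convention for
  \<open>L_k\<close>.\<close>

lemma sel_W_mult_sel_weight:
  assumes "\<And>l. l < m \<Longrightarrow> 0 \<le> \<alpha> k l" "\<And>l. l < m \<Longrightarrow> 0 \<le> W l" "l < m"
  shows "sel_W m \<alpha> W k * sel_weight m \<alpha> W k l = \<alpha> k l * W l"
proof (cases "sel_W m \<alpha> W k = 0")
  case True
  then have "\<alpha> k l * W l = 0"
    using assms unfolding sel_W_def by (subst (asm) sum_nonneg_eq_0_iff) auto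
  with True show ?thesis by simp
qed (simp add: sel_weight_def)

lemma W_stage_nonneg:
  assumes "\<And>k. k < m \<Longrightarrow> 0 \<le> W k" "k < m"
  shows "0 \<le> W_stage m \<tau> W j k"
  using assms(2) by (induction j arbitrary: k) (auto intro!: sel_W_nonneg alpha_mat_nonneg assms(1))

lemma W_res_nonneg:
  assumes "k < m" "0 \<le> W k" "xi \<in> space (cfg_space m M X)" "\<And>x. x \<in> space X \<Longrightarrow> 0 \<le> gn x"
  shows "0 \<le> W_res m M gn W xi k"
  unfolding W_res_def using assms
  by (intro mult_nonneg_nonneg sum_nonneg) (auto dest: block_in_space particle_in_space)

lemma measurable_W_res:
  assumes z: "z \<in> A \<rightarrow>\<^sub>M cfg_space m M X" and [measurable]: "gn \<in> borel_measurable X"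
    and [measurable]: "(\<lambda>a. w a k) \<in> borel_measurable A" and k: "k < m"
  shows "(\<lambda>a. W_res m M gn (w a) (z a) k) \<in> borel_measurable A"
proof -
  have [measurable]: "(\<lambda>a. z a k i) \<in> A \<rightarrow>\<^sub>M X" if "i \<in> {..<M}" for i
    using measurable_particle[OF z k] that by simp
  show ?thesis unfolding W_res_def by measurable
qed

lemma measurable_alpha_mat:
  assumes [measurable]: "\<And>k. k \<in> {..<m} \<Longrightarrow> (\<lambda>a. w a k) \<in> borel_measurable A"
  shows "(\<lambda>a. alpha_mat m \<tau> s (w a) k l) \<in> borel_measurable A"
proof -
  \<comment> \<open>Moving the entry inside the conditional reduces the choice of a matrix to a case
    split between two real constants on a measurable event.\<close>
  have "(\<lambda>a. alpha_mat m \<tau> s (w a) k l) = (\<lambda>a. if eff_filters m (w a) < \<tau> then A_mat s k l else idm k l)"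
    by (simp add: alpha_mat_def fun_eq_iff)
  then show ?thesis unfolding eff_filters_def by simp
qed

lemma measurable_W_stage:
  assumes w: "\<And>k. k < m \<Longrightarrow> (\<lambda>a. w a k) \<in> borel_measurable A" and "k < m"
  shows "(\<lambda>a. W_stage m \<tau> (w a) j k) \<in> borel_measurable A"
  using \<open>k < m\<close>
proof (induction j arbitrary: k)
  case (Suc j)
  then have [measurable]: "(\<lambda>a. W_stage m \<tau> (w a) j l) \<in> borel_measurable A" if "l \<in> {..<m}" for l
    using that by simp
  have [measurable]: "(\<lambda>a. alpha_mat m \<tau> (Suc j) (W_stage m \<tau> (w a) j) k l) \<in> borel_measurable A" for l
    by (rule measurable_alpha_mat) simp
  show ?case by (simp add: sel_W_def)
qed (simp add: w)

lemma measurable_resamp_stage: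
  assumes z: "z \<in> A \<rightarrow>\<^sub>M cfg_space m M X" and gn[measurable]: "gn \<in> borel_measurable X"
    and nn: "\<And>x. x \<in> space X \<Longrightarrow> 0 \<le> gn x"
  shows "(\<lambda>a. resamp_stage m M X gn (z a)) \<in> A \<rightarrow>\<^sub>M prob_algebra (cfg_space m M X)"
  unfolding resamp_stage_def cfg_space_def
proof (intro measurable_PiM_kernel)
  fix k assume "k \<in> {..<m}"
  then have k: "k < m" by simp
  have b: "z a k \<in> space (block_space M X)" if "a \<in> space A" for a
    using that measurable_space[OF measurable_block[OF z k]] by simp
  show "(\<lambda>a. PiM {..<M} (\<lambda>i. resamp_dist M X gn (z a k) i)) \<in> A \<rightarrow>\<^sub>M prob_algebra (block_space M X)"
    unfolding block_space_def
  proof (intro measurable_PiM_kernel)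
    fix i assume i: "i \<in> {..<M}"
    have [measurable]: "(\<lambda>a. z a k j) \<in> A \<rightarrow>\<^sub>M X" if "j \<in> {..<M}" for j
      using measurable_particle[OF z k] that by simp
    have "(\<lambda>a. distr (density (count_space {..<M}) (\<lambda>j. ennreal (resamp_weight M gn (z a k) i j))) X (z a k))
        \<in> A \<rightarrow>\<^sub>M prob_algebra X"
    proof (rule measurable_distr_density_count_space)
      show "(\<lambda>a. resamp_weight M gn (z a k) i j) \<in> borel_measurable A" if "j \<in> {..<M}" for j
        using that unfolding resamp_weight_def by measurable
      show "0 \<le> resamp_weight M gn (z a k) i j" if "a \<in> space A" "j \<in> {..<M}" for a j
        using that b nn by (auto intro!: resamp_weight_nonneg dest: particle_in_space)
    qed (use i in \<open>auto simp: resamp_weight_sum\<close>)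
    then show "(\<lambda>a. resamp_dist M X gn (z a k) i) \<in> A \<rightarrow>\<^sub>M prob_algebra X"
      using i b by (simp add: resamp_dist_eq cong: measurable_cong)
  qed simp
qed simp

lemma measurable_sel_stage:
  assumes z: "z \<in> A \<rightarrow>\<^sub>M cfg_space m M X"
    and \<alpha>[measurable]: "\<And>k l. (\<lambda>a. \<alpha> a k l) \<in> borel_measurable A"
    and w: "\<And>k. k < m \<Longrightarrow> (\<lambda>a. w a k) \<in> borel_measurable A"
    and \<alpha>_nn: "\<And>a k l. a \<in> space A \<Longrightarrow> 0 \<le> \<alpha> a k l" and w_nn: "\<And>a k. a \<in> space A \<Longrightarrow> k < m \<Longrightarrow> 0 \<le> w a k"
  shows "(\<lambda>a. sel_stage m M X (\<alpha> a) (w a) (z a)) \<in> A \<rightarrow>\<^sub>M prob_algebra (cfg_space m M X)"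
  unfolding sel_stage_def cfg_space_def
proof (intro measurable_PiM_kernel)
  fix k assume k: "k \<in> {..<m}"
  have [measurable]: "(\<lambda>a. w a l) \<in> borel_measurable A" if "l \<in> {..<m}" for l
    using w that by simp
  have "(\<lambda>a. distr (density (count_space {..<m}) (\<lambda>l. ennreal (sel_weight m (\<alpha> a) (w a) k l))) (block_space M X) (z a))
      \<in> A \<rightarrow>\<^sub>M prob_algebra (block_space M X)"
  proof (rule measurable_distr_density_count_space)
    show "(\<lambda>a. sel_weight m (\<alpha> a) (w a) k l) \<in> borel_measurable A" if "l \<in> {..<m}" for l
      using that unfolding sel_weight_def sel_W_def by measurable
  qed (use k in \<open>auto simp: sel_weight_sum intro!: sel_weight_nonneg \<alpha>_nn w_nn measurable_block[OF z]\<close>)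
  then show "(\<lambda>a. distr (L_dist m (\<alpha> a) (w a) k) (block_space M X) (\<lambda>l. z a l)) \<in> A \<rightarrow>\<^sub>M prob_algebra (block_space M X)"
    using k by (simp add: L_dist_eq)
qed simp

lemma measurable_mut_stage:
  assumes z: "z \<in> A \<rightarrow>\<^sub>M cfg_space m M X" and Kn: "Kn \<in> X \<rightarrow>\<^sub>M prob_algebra X"
  shows "(\<lambda>a. mut_stage m M Kn (z a)) \<in> A \<rightarrow>\<^sub>M prob_algebra (cfg_space m M X)"
  unfolding mut_stage_def cfg_space_def block_space_def
  by (intro measurable_PiM_kernel measurable_compose[OF measurable_particle[OF z] Kn]) auto

text \<open>The weights of every stage are functions of the parameter \<open>a\<close> alone;
  intermediate configurations never influence them.\<close>

lemma measurable_xi_chain: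
  assumes z: "z \<in> A \<rightarrow>\<^sub>M cfg_space m M X" and gn[measurable]: "gn \<in> borel_measurable X"
    and nn: "\<And>x. x \<in> space X \<Longrightarrow> 0 \<le> gn x"
    and w: "\<And>k. k < m \<Longrightarrow> (\<lambda>a. w a k) \<in> borel_measurable A"
    and w_nn: "\<And>a k. a \<in> space A \<Longrightarrow> k < m \<Longrightarrow> 0 \<le> w a k"
  shows "(\<lambda>a. xi_chain m M X gn \<tau> (w a) (z a) j) \<in> A \<rightarrow>\<^sub>M prob_algebra (cfg_space m M X)"
proof (induction j)
  case 0
  show ?case by (simp add: measurable_resamp_stage[OF z gn nn])
next
  case (Suc j)
  let ?W = "\<lambda>a. W_stage m \<tau> (W_res m M gn (w a) (z a)) j"
  have W: "(\<lambda>a. ?W a k) \<in> borel_measurable A" if "k < m" for k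
    using that by (intro measurable_W_stage measurable_W_res[OF z gn] w)
  have W_nn: "0 \<le> ?W a k" if "a \<in> space A" "k < m" for a k
    using that by (intro W_stage_nonneg W_res_nonneg[where X=X] w_nn measurable_space[OF z] nn)
  \<comment> \<open>The first component determines matrix and weights; the second is the
    intermediate configuration from which blocks are selected.\<close>
  have "(\<lambda>p. sel_stage m M X (alpha_mat m \<tau> (Suc j) (?W (fst p))) (?W (fst p)) (snd p))
      \<in> A \<Otimes>\<^sub>M cfg_space m M X \<rightarrow>\<^sub>M prob_algebra (cfg_space m M X)"
    by (intro measurable_sel_stage measurable_alpha_mat measurable_compose[OF measurable_fst W] measurable_snd)
       (auto simp: space_pair_measure intro: alpha_mat_nonneg W_nn)
  then show ?case
    using Suc.IH by (simp add: measurable_bind_prob_space2 case_prod_unfold)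
qed

lemma measurable_airpf_step:
  assumes "z \<in> A \<rightarrow>\<^sub>M cfg_space (2 ^ Sm) M X" "g n \<in> borel_measurable X"
    and "\<And>x. x \<in> space X \<Longrightarrow> 0 \<le> g n x"
    and "\<And>k. k < 2 ^ Sm \<Longrightarrow> (\<lambda>a. w a k) \<in> borel_measurable A"
    and "\<And>a k. a \<in> space A \<Longrightarrow> k < 2 ^ Sm \<Longrightarrow> 0 \<le> w a k"
    and K: "K (Suc n) \<in> X \<rightarrow>\<^sub>M prob_algebra X"
  shows "(\<lambda>a. airpf_step X K g Sm M \<tau> n (w a) (z a)) \<in> A \<rightarrow>\<^sub>M prob_algebra (cfg_space (2 ^ Sm) M X)"
  unfolding airpf_step_def
  by (intro measurable_bind_prob_space[OF measurable_xi_chain measurable_mut_stage] assms measurable_ident[unfolded id_def])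

section \<open>Integrals, measurability and bounds for weighted sums over blocks\<close>

lemma prob_space_distr_density_count_space:
  fixes w :: "'c \<Rightarrow> real"
  assumes "finite I" "\<And>j. j \<in> I \<Longrightarrow> 0 \<le> w j" "(\<Sum>j\<in>I. w j) = 1" "\<And>j. j \<in> I \<Longrightarrow> x j \<in> space X"
  shows "prob_space (distr (density (count_space I) (\<lambda>j. ennreal (w j))) X x)"
  \<comment> \<open>A fixed law is treated as a kernel over the one-point space
    \<open>unit\<close>.\<close>
  using measurable_distr_density_count_space[of I "\<lambda>_::unit. w" "count_space UNIV" "\<lambda>_. x" X, THEN measurable_space, of "()"] assms
  by (simp add: space_prob_algebra)

text \<open>Each summand depends on a single coordinate, so linearity reduces the integral to the
  marginals; the uniform bound provides integrability.\<close>

lemma integral_PiM_sum_components: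
  fixes f :: "'i \<Rightarrow> 'b \<Rightarrow> real"
  assumes M: "\<And>i. i \<in> I \<Longrightarrow> prob_space (M i)" and f: "\<And>i. i \<in> I \<Longrightarrow> f i \<in> borel_measurable (M i)"
    and B: "\<And>i x. i \<in> I \<Longrightarrow> x \<in> space (M i) \<Longrightarrow> \<bar>f i x\<bar> \<le> B"
  shows "(\<integral>\<omega>. (\<Sum>i\<in>I. c i * f i (\<omega> i)) \<partial>PiM I M) = (\<Sum>i\<in>I. c i * (\<integral>x. f i x \<partial>M i))"
proof -
  interpret prob_space "PiM I M" by (intro prob_space_PiM M)
  have "integrable (PiM I M) (\<lambda>\<omega>. f i (\<omega> i))" if "i \<in> I" for i
    using that by (intro integrable_const_bound[of _ B] AE_I2
        measurable_compose[OF measurable_component_singleton[of i I M] f])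
      (auto intro!: B simp: space_PiM)
  then show ?thesis
    by (simp add: integral_PiM_component M f)
qed

lemma block_mean_measurable:
  fixes f :: "'a \<Rightarrow> real"
  assumes "f \<in> borel_measurable X"
  shows "(\<lambda>b. (1 / real M) * (\<Sum>i<M. f (b i))) \<in> borel_measurable (block_space M X)"
  unfolding block_space_def
  by (intro borel_measurable_times borel_measurable_sum borel_measurable_const
      measurable_compose[OF measurable_component_singleton[of _ "{..<M}" "\<lambda>_. X"] assms]) simp

lemma block_mean_bound:
  fixes f :: "'a \<Rightarrow> real"
  assumes "1 \<le> M" "\<And>x. x \<in> space X \<Longrightarrow> \<bar>f x\<bar> \<le> B" "b \<in> space (block_space M X)"
  shows "\<bar>(1 / real M) * (\<Sum>i<M. f (b i))\<bar> \<le> B"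
proof -
  have "\<bar>\<Sum>i<M. f (b i)\<bar> \<le> (\<Sum>i<M. B)"
    using assms by (intro order_trans[OF sum_abs] sum_mono) (auto dest: particle_in_space)
  then show ?thesis using assms(1) by (simp add: abs_mult field_simps)
qed

lemma cfg_sum_measurable:
  fixes F :: "(nat \<Rightarrow> 'a) \<Rightarrow> real"
  assumes "F \<in> borel_measurable (block_space M X)"
  shows "(\<lambda>z. \<Sum>k<m. c k * F (z k)) \<in> borel_measurable (cfg_space m M X)"
  unfolding cfg_space_def
  by (intro borel_measurable_times borel_measurable_sum borel_measurable_const
      measurable_compose[OF measurable_component_singleton[of _ "{..<m}" "\<lambda>_. block_space M X"] assms]) simp

lemma cfg_sum_bound:
  fixes F :: "(nat \<Rightarrow> 'a) \<Rightarrow> real"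
  assumes "\<And>b. b \<in> space (block_space M X) \<Longrightarrow> \<bar>F b\<bar> \<le> B" "z \<in> space (cfg_space m M X)"
  shows "\<bar>\<Sum>k<m. c k * F (z k)\<bar> \<le> (\<Sum>k<m. \<bar>c k\<bar> * B)"
  using assms by (intro order_trans[OF sum_abs] sum_mono)
    (auto simp: abs_mult intro!: mult_left_mono dest: block_in_space)

subsection \<open>Conditional means\<close>

text \<open>The normaliser of the resampling law of block \<open>k\<close> is also a factor of
  \<open>W_res\<close>. Multiplying the mean by it, instead of dividing, makes the cancellation
  valid when all potentials of the block vanish.\<close>

lemma integral_resamp_stage:
  assumes M: "1 \<le> M" and xi: "xi \<in> space (cfg_space m M X)"
    and nn: "\<And>x. x \<in> space X \<Longrightarrow> 0 \<le> gn x"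
    and \<psi>[measurable]: "\<psi> \<in> borel_measurable X" and B: "\<And>x. x \<in> space X \<Longrightarrow> \<bar>\<psi> x\<bar> \<le> B"
  shows "(\<integral>z. (\<Sum>k<m. W_res m M gn W xi k * ((1/M) * (\<Sum>i<M. \<psi> (z k i)))) \<partial>resamp_stage m M X gn xi)
    = (\<Sum>k<m. W k * ((1/M) * (\<Sum>i<M. gn (xi k i) * \<psi> (xi k i))))"
proof -
  let ?R = "\<lambda>k i. resamp_dist M X gn (xi k) i"
  have b: "xi k \<in> space (block_space M X)" if "k < m" for k
    using xi that by (rule block_in_space)
  have gn_nn: "0 \<le> gn (xi k j)" if "k < m" "j < M" for k j
    using that b nn by (auto dest: particle_in_space)
  have Rp: "prob_space (?R k i)" if "k < m" "i < M" for k i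
    using that b gn_nn unfolding resamp_dist_eq[OF that(2) b[OF that(1)]]
    by (intro prob_space_distr_density_count_space)
      (auto simp: resamp_weight_sum intro!: resamp_weight_nonneg dest: particle_in_space)
  have Rs: "sets (?R k i) = sets X" for k i
    by (simp add: resamp_dist_def)
  note Rsp = sets_eq_imp_space_eq[OF Rs]
  have Rb: "sets (PiM {..<M} (?R k)) = sets (block_space M X)" for k
    unfolding block_space_def by (intro sets_PiM_cong Rs refl)
  have R\<psi>: "(\<integral>x. \<psi> x \<partial>?R k i) = (\<Sum>j<M. resamp_weight M gn (xi k) i j * \<psi> (xi k j))" if "k < m" "i < M" for k i
    using that b gn_nn unfolding resamp_dist_eq[OF that(2) b[OF that(1)]]
    by (intro integral_distr_density_count_space)
      (auto intro!: resamp_weight_nonneg dest: particle_in_space)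
  have "(\<integral>z. (\<Sum>k<m. W_res m M gn W xi k * ((1/M) * (\<Sum>i<M. \<psi> (z k i)))) \<partial>resamp_stage m M X gn xi)
      = (\<Sum>k<m. W_res m M gn W xi k * (\<integral>b. (1/M) * (\<Sum>i<M. \<psi> (b i)) \<partial>PiM {..<M} (?R k)))"
    unfolding resamp_stage_def
  proof (rule integral_PiM_sum_components)
    show "prob_space (PiM {..<M} (?R k))" if "k \<in> {..<m}" for k
      using that by (intro prob_space_PiM Rp) auto
    show "(\<lambda>b. 1 / real M * (\<Sum>i<M. \<psi> (b i))) \<in> borel_measurable (PiM {..<M} (?R k))" for k
      using block_mean_measurable[OF \<psi>] by (simp add: measurable_cong_sets[OF Rb refl])
    show "\<bar>1 / real M * (\<Sum>i<M. \<psi> (b i))\<bar> \<le> B" if "b \<in> space (PiM {..<M} (?R k))" for k b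
      using that block_mean_bound[of M X \<psi> B] M B by (simp add: sets_eq_imp_space_eq[OF Rb])
  qed
  also have "\<dots> = (\<Sum>k<m. W k * ((1/M) * (\<Sum>i<M. gn (xi k i) * \<psi> (xi k i))))"
  proof (rule sum.cong[OF refl])
    fix k assume "k \<in> {..<m}"
    then have k: "k < m" by simp
    let ?G = "\<Sum>j<M. gn (xi k j)"
    \<comment> \<open>Distributing \<open>1/M\<close> gives a weighted sum over the particles, so
      the component formula applies a second time, now to the inner product.\<close>
    have "(\<integral>b. (1/M) * (\<Sum>i<M. \<psi> (b i)) \<partial>PiM {..<M} (?R k)) = (\<integral>b. (\<Sum>i<M. (1/M) * \<psi> (b i)) \<partial>PiM {..<M} (?R k))"
      by (simp only: sum_distrib_left)
    also have "\<dots> = (\<Sum>i<M. (1/M) * (\<integral>x. \<psi> x \<partial>?R k i))"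
      by (rule integral_PiM_sum_components[where f="\<lambda>_. \<psi>" and B=B])
        (auto simp: Rp k Rsp B measurable_cong_sets[OF Rs refl])
    also have "\<dots> = (1/M) * (\<Sum>i<M. \<Sum>j<M. resamp_weight M gn (xi k) i j * \<psi> (xi k j))"
      by (simp only: sum_distrib_left) (auto intro!: sum.cong simp: R\<psi>[OF k] sum_distrib_left)
    finally have "?G * (\<integral>b. (1/M) * (\<Sum>i<M. \<psi> (b i)) \<partial>PiM {..<M} (?R k))
        = (1/M) * (\<Sum>i<M. \<Sum>j<M. (?G * resamp_weight M gn (xi k) i j) * \<psi> (xi k j))"
      by (simp add: sum_distrib_left mult.assoc)
    also have "\<dots> = (1/M) * (\<Sum>i<M. \<Sum>j<M. gn (xi k j) * \<psi> (xi k j))"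
      by (simp add: sum_mult_resamp_weight gn_nn k)
    \<comment> \<open>The inner sum no longer depends on \<open>i\<close>; its \<open>M\<close>
      equal copies cancel \<open>1/M\<close>.\<close>
    also have "\<dots> = (\<Sum>j<M. gn (xi k j) * \<psi> (xi k j))"
      using M by simp
    finally have G: "?G * (\<integral>b. (1/M) * (\<Sum>i<M. \<psi> (b i)) \<partial>PiM {..<M} (?R k)) = (\<Sum>j<M. gn (xi k j) * \<psi> (xi k j))" .
    show "W_res m M gn W xi k * (\<integral>b. (1/M) * (\<Sum>i<M. \<psi> (b i)) \<partial>PiM {..<M} (?R k))
        = W k * ((1/M) * (\<Sum>i<M. gn (xi k i) * \<psi> (xi k i)))"
      unfolding W_res_def by (simp only: mult.assoc G)
  qed
  finally show ?thesis .
qed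

text \<open>The new weight of filter \<open>k\<close> cancels the normaliser of its index law,
  leaving the terms \<open>\<alpha> k l * W l * F (xi l)\<close>. Summing over \<open>k\<close>
  first produces the column sums of \<open>\<alpha>\<close>.\<close>

lemma integral_sel_stage:
  fixes F :: "(nat \<Rightarrow> 'a) \<Rightarrow> real"
  assumes xi: "xi \<in> space (cfg_space m M X)" and \<alpha>: "\<And>k l. 0 \<le> \<alpha> k l"
    and col: "\<And>l. l < m \<Longrightarrow> (\<Sum>k<m. \<alpha> k l) = 1" and W: "\<And>l. l < m \<Longrightarrow> 0 \<le> W l"
    and F: "F \<in> borel_measurable (block_space M X)" and B: "\<And>b. b \<in> space (block_space M X) \<Longrightarrow> \<bar>F b\<bar> \<le> B"
  shows "(\<integral>z. (\<Sum>k<m. sel_W m \<alpha> W k * F (z k)) \<partial>sel_stage m M X \<alpha> W xi) = (\<Sum>l<m. W l * F (xi l))"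
proof -
  let ?D = "\<lambda>k. distr (L_dist m \<alpha> W k) (block_space M X) (\<lambda>l. xi l)"
  note b = block_in_space[OF xi]
  have "(\<integral>z. (\<Sum>k<m. sel_W m \<alpha> W k * F (z k)) \<partial>sel_stage m M X \<alpha> W xi)
      = (\<Sum>k<m. sel_W m \<alpha> W k * (\<integral>b. F b \<partial>?D k))"
    unfolding sel_stage_def
  proof (rule integral_PiM_sum_components[where B=B])
    show "prob_space (?D k)" if "k \<in> {..<m}" for k
      using that b unfolding L_dist_eq[OF that[unfolded lessThan_iff]]
      by (intro prob_space_distr_density_count_space)
        (auto simp: sel_weight_sum intro!: sel_weight_nonneg \<alpha> W)
  qed (auto simp: F B)
  also have "\<dots> = (\<Sum>k<m. \<Sum>l<m. \<alpha> k l * (W l * F (xi l)))"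
  proof (rule sum.cong[OF refl])
    fix k assume "k \<in> {..<m}"
    then have k: "k < m" by simp
    have "(\<integral>b. F b \<partial>?D k) = (\<Sum>l<m. sel_weight m \<alpha> W k l * F (xi l))"
      using b unfolding L_dist_eq[OF k]
      by (intro integral_distr_density_count_space) (auto intro!: sel_weight_nonneg \<alpha> W F)
    then show "sel_W m \<alpha> W k * (\<integral>b. F b \<partial>?D k) = (\<Sum>l<m. \<alpha> k l * (W l * F (xi l)))"
      by (simp add: sum_distrib_left sel_W_mult_sel_weight \<alpha> W flip: mult.assoc)
  qed
  also have "\<dots> = (\<Sum>l<m. (\<Sum>k<m. \<alpha> k l) * (W l * F (xi l)))"
    by (subst sum.swap) (simp add: sum_distrib_right)
  finally show ?thesis by (simp add: col)
qed

lemma integral_mut_stage: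
  assumes M: "1 \<le> M" and xi: "xi \<in> space (cfg_space m M X)" and Kn: "Kn \<in> X \<rightarrow>\<^sub>M prob_algebra X"
    and \<phi>: "\<phi> \<in> borel_measurable X" and B: "\<And>x. x \<in> space X \<Longrightarrow> \<bar>\<phi> x\<bar> \<le> B"
  shows "(\<integral>z. (\<Sum>k<m. c k * ((1/M) * (\<Sum>i<M. \<phi> (z k i)))) \<partial>mut_stage m M Kn xi)
    = (\<Sum>k<m. c k * ((1/M) * (\<Sum>i<M. (\<integral>y. \<phi> y \<partial>Kn (xi k i)))))"
proof -
  let ?R = "\<lambda>k i. Kn (xi k i)"
  have Rps: "sets (?R k i) = sets X" "prob_space (?R k i)" if "k < m" "i < M" for k i
    using measurable_space[OF Kn particle_in_space[OF block_in_space[OF xi]], OF that]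
    by (auto simp: space_prob_algebra)
  note Rsp = sets_eq_imp_space_eq[OF Rps(1)]
  have Rb: "sets (PiM {..<M} (?R k)) = sets (block_space M X)" if "k < m" for k
    unfolding block_space_def using that by (intro sets_PiM_cong Rps refl) auto
  have "(\<integral>z. (\<Sum>k<m. c k * ((1/M) * (\<Sum>i<M. \<phi> (z k i)))) \<partial>mut_stage m M Kn xi)
      = (\<Sum>k<m. c k * (\<integral>b. (1/M) * (\<Sum>i<M. \<phi> (b i)) \<partial>PiM {..<M} (?R k)))"
    unfolding mut_stage_def
  proof (rule integral_PiM_sum_components)
    show "prob_space (PiM {..<M} (?R k))" if "k \<in> {..<m}" for k
      using that by (intro prob_space_PiM Rps) auto
    show "(\<lambda>b. 1 / real M * (\<Sum>i<M. \<phi> (b i))) \<in> borel_measurable (PiM {..<M} (?R k))" if "k \<in> {..<m}" for k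
      using block_mean_measurable[OF \<phi>] that by (simp add: measurable_cong_sets[OF Rb refl])
    show "\<bar>1 / real M * (\<Sum>i<M. \<phi> (b i))\<bar> \<le> B" if "k \<in> {..<m}" "b \<in> space (PiM {..<M} (?R k))" for k b
      using that block_mean_bound[of M X \<phi> B] M B by (simp add: sets_eq_imp_space_eq[OF Rb])
  qed
  also have "\<dots> = (\<Sum>k<m. c k * ((1/M) * (\<Sum>i<M. (\<integral>y. \<phi> y \<partial>Kn (xi k i)))))"
  proof (rule sum.cong[OF refl])
    fix k assume "k \<in> {..<m}"
    then have k: "k < m" by simp
    have "(\<integral>b. (1/M) * (\<Sum>i<M. \<phi> (b i)) \<partial>PiM {..<M} (?R k)) = (\<integral>b. (\<Sum>i<M. (1/M) * \<phi> (b i)) \<partial>PiM {..<M} (?R k))"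
      by (simp only: sum_distrib_left)
    also have "\<dots> = (\<Sum>i<M. (1/M) * (\<integral>x. \<phi> x \<partial>?R k i))"
      by (rule integral_PiM_sum_components[where f="\<lambda>_. \<phi>" and B=B])
        (auto simp: Rps k Rsp B \<phi> measurable_cong_sets[OF Rps(1) refl])
    finally show "c k * (\<integral>b. (1/M) * (\<Sum>i<M. \<phi> (b i)) \<partial>PiM {..<M} (?R k))
        = c k * ((1/M) * (\<Sum>i<M. (\<integral>y. \<phi> y \<partial>Kn (xi k i))))"
      by (simp only: sum_distrib_left)
  qed
  finally show ?thesis .
qed

section \<open>Composition of the stages into one time step\<close>

lemma sum_W_stage:
  assumes "j \<le> Sm"
  shows "(\<Sum>k<2^Sm. W_stage (2^Sm) \<tau> W j k) = (\<Sum>k<2^Sm. W k)"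
  using assms
proof (induction j)
  case (Suc j)
  let ?W = "W_stage (2^Sm) \<tau> W j"
  have "(\<Sum>k<2^Sm. W_stage (2^Sm) \<tau> W (Suc j) k)
      = (\<Sum>l<2^Sm. (\<Sum>k<2^Sm. alpha_mat (2^Sm) \<tau> (Suc j) ?W k l) * ?W l)"
    unfolding W_stage.simps sel_W_def by (subst sum.swap) (simp add: sum_distrib_right)
  also have "\<dots> = (\<Sum>l<2^Sm. ?W l)"
    \<comment> \<open>The premise \<open>Suc j \<le> Sm\<close> places the matrix index in the range
      where columns sum to one.\<close>
    using Suc.prems by (intro sum.cong refl) (simp add: alpha_mat_col_sum)
  finally show ?case using Suc by simp
qed simp

lemma xi_chain_in_prob_algebra:
  assumes "xi \<in> space (cfg_space m M X)" "gn \<in> borel_measurable X"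
    and "\<And>x. x \<in> space X \<Longrightarrow> 0 \<le> gn x" "\<And>k. k < m \<Longrightarrow> 0 \<le> W k"
  shows "xi_chain m M X gn \<tau> W xi j \<in> space (prob_algebra (cfg_space m M X))"
  using measurable_xi_chain[of "\<lambda>z. z" "cfg_space m M X" m M X gn "\<lambda>_. W" \<tau> j, THEN measurable_space] assms
  by simp

text \<open>Each induction step integrates out the last selection, whose matrix and weights are
  fixed by the initial \<open>W\<close> and \<open>xi\<close>. \<open>F\<close> takes whole blocks
  because selection copies whole blocks.\<close>

lemma integral_xi_chain:
  fixes F :: "(nat \<Rightarrow> 'a) \<Rightarrow> real"
  assumes xi: "xi \<in> space (cfg_space (2^Sm) M X)" and gn: "gn \<in> borel_measurable X"
    and nn: "\<And>x. x \<in> space X \<Longrightarrow> 0 \<le> gn x" and W: "\<And>k. k < 2^Sm \<Longrightarrow> 0 \<le> W k"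
    and F: "F \<in> borel_measurable (block_space M X)" and B: "\<And>b. b \<in> space (block_space M X) \<Longrightarrow> \<bar>F b\<bar> \<le> B"
    and "j \<le> Sm"
  shows "(\<integral>z. (\<Sum>k<2^Sm. W_stage (2^Sm) \<tau> (W_res (2^Sm) M gn W xi) j k * F (z k)) \<partial>xi_chain (2^Sm) M X gn \<tau> W xi j)
    = (\<integral>z. (\<Sum>k<2^Sm. W_res (2^Sm) M gn W xi k * F (z k)) \<partial>resamp_stage (2^Sm) M X gn xi)"
  using \<open>j \<le> Sm\<close>
proof (induction j)
  case (Suc j)
  let ?m = "2^Sm"
  let ?W = "W_stage ?m \<tau> (W_res ?m M gn W xi) j"
  let ?\<alpha> = "alpha_mat ?m \<tau> (Suc j) ?W"
  let ?C = "xi_chain ?m M X gn \<tau> W xi j"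
  have W_nn: "0 \<le> ?W k" if "k < ?m" for k
    using that by (intro W_stage_nonneg W_res_nonneg[where X=X] W xi nn)
  have C: "?C \<in> space (prob_algebra (cfg_space ?m M X))"
    by (rule xi_chain_in_prob_algebra[OF xi gn nn W])
  have sp: "space ?C = space (cfg_space ?m M X)"
    using C by (auto simp: space_prob_algebra dest: sets_eq_imp_space_eq)
  have \<kappa>: "(\<lambda>z. sel_stage ?m M X ?\<alpha> ?W z) \<in> cfg_space ?m M X \<rightarrow>\<^sub>M prob_algebra (cfg_space ?m M X)"
    by (rule measurable_sel_stage) (auto intro: alpha_mat_nonneg W_nn)
  have "(\<integral>z. (\<Sum>k<?m. sel_W ?m ?\<alpha> ?W k * F (z k)) \<partial>(?C \<bind> (\<lambda>z. sel_stage ?m M X ?\<alpha> ?W z)))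
      = (\<integral>y. (\<integral>z. (\<Sum>k<?m. sel_W ?m ?\<alpha> ?W k * F (z k)) \<partial>sel_stage ?m M X ?\<alpha> ?W y) \<partial>?C)"
    by (rule integral_bind_prob_algebra[OF C \<kappa> cfg_sum_measurable[OF F]]) (rule cfg_sum_bound[OF B])
  also have "\<dots> = (\<integral>y. (\<Sum>k<?m. ?W k * F (y k)) \<partial>?C)"
    using Suc.prems
    by (intro Bochner_Integration.integral_cong refl integral_sel_stage[where B=B] F B W_nn alpha_mat_nonneg alpha_mat_col_sum)
      (auto simp: sp)
  finally show ?case using Suc by simp
qed simp

lemma integral_kernel_bound:
  fixes \<phi> :: "'a \<Rightarrow> real"
  assumes "Kn \<in> X \<rightarrow>\<^sub>M prob_algebra X" "\<phi> \<in> borel_measurable X"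
    "\<And>x. x \<in> space X \<Longrightarrow> \<bar>\<phi> x\<bar> \<le> B" "x \<in> space X"
  shows "\<bar>\<integral>y. \<phi> y \<partial>Kn x\<bar> \<le> B"
proof -
  have *: "sets (Kn x) = sets X" "prob_space (Kn x)"
    using measurable_space[OF assms(1,4)] by (auto simp: space_prob_algebra)
  show ?thesis
    using assms(2,3) by (intro prob_space.abs_expectation_le[OF *(2)])
      (auto simp: sets_eq_imp_space_eq[OF *(1)] measurable_cong_sets[OF *(1) refl])
qed

lemma integral_kernel_measurable:
  fixes \<phi> :: "'a \<Rightarrow> real"
  assumes "Kn \<in> X \<rightarrow>\<^sub>M prob_algebra X" "\<phi> \<in> borel_measurable X"
  shows "(\<lambda>x. \<integral>y. \<phi> y \<partial>Kn x) \<in> borel_measurable X"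
  using measurable_compose[OF measurable_prob_algebraD[OF assms(1)] integral_measurable_subprob_algebra[OF assms(2)]] .

text \<open>The stages are integrated out from last to first. The final weights depend only on
  \<open>W\<close> and \<open>xi\<close>, so they act as constant coefficients throughout.\<close>

lemma integral_airpf_step:
  assumes M: "1 \<le> M" and xi: "xi \<in> space (cfg_space (2^Sm) M X)" and gn: "g n \<in> borel_measurable X"
    and nn: "\<And>x. x \<in> space X \<Longrightarrow> 0 \<le> g n x" and W: "\<And>k. k < 2^Sm \<Longrightarrow> 0 \<le> W k"
    and K: "K (Suc n) \<in> X \<rightarrow>\<^sub>M prob_algebra X"
    and \<phi>: "\<phi> \<in> borel_measurable X" and B: "\<And>x. x \<in> space X \<Longrightarrow> \<bar>\<phi> x\<bar> \<le> B"
  shows "(\<integral>z. (\<Sum>k<2^Sm. airpf_Wnext (g n) Sm M \<tau> n W xi k * ((1/M) * (\<Sum>i<M. \<phi> (z k i)))) \<partial>airpf_step X K g Sm M \<tau> n W xi)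
    = (\<Sum>k<2^Sm. W k * ((1/M) * (\<Sum>i<M. g n (xi k i) * (\<integral>y. \<phi> y \<partial>K (Suc n) (xi k i)))))"
proof -
  let ?m = "2^Sm"
  let ?V = "airpf_Wnext (g n) Sm M \<tau> n W xi"
  let ?\<psi> = "\<lambda>x. \<integral>y. \<phi> y \<partial>K (Suc n) x"
  let ?C = "xi_chain ?m M X (g n) \<tau> W xi Sm"
  have \<psi>: "?\<psi> \<in> borel_measurable X"
    by (rule integral_kernel_measurable[OF K \<phi>])
  have \<psi>_B: "\<bar>?\<psi> x\<bar> \<le> B" if "x \<in> space X" for x
    by (rule integral_kernel_bound[OF K \<phi> B that])
  have C: "?C \<in> space (prob_algebra (cfg_space ?m M X))"
    by (rule xi_chain_in_prob_algebra[OF xi gn nn W])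
  have sp: "space ?C = space (cfg_space ?m M X)"
    using C by (auto simp: space_prob_algebra dest: sets_eq_imp_space_eq)
  have "(\<integral>z. (\<Sum>k<?m. ?V k * ((1/M) * (\<Sum>i<M. \<phi> (z k i)))) \<partial>airpf_step X K g Sm M \<tau> n W xi)
      = (\<integral>y. (\<integral>z. (\<Sum>k<?m. ?V k * ((1/M) * (\<Sum>i<M. \<phi> (z k i)))) \<partial>mut_stage ?m M (K (Suc n)) y) \<partial>?C)"
    unfolding airpf_step_def
    by (rule integral_bind_prob_algebra[OF C measurable_mut_stage[OF measurable_ident[unfolded id_def] K]
          cfg_sum_measurable[OF block_mean_measurable[OF \<phi>]]])
      (rule cfg_sum_bound[OF block_mean_bound[OF M B]])
  also have "\<dots> = (\<integral>y. (\<Sum>k<?m. ?V k * ((1/M) * (\<Sum>i<M. ?\<psi> (y k i)))) \<partial>?C)"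
    by (intro Bochner_Integration.integral_cong refl integral_mut_stage[OF M _ K \<phi> B]) (auto simp: sp)
  also have "\<dots> = (\<integral>z. (\<Sum>k<?m. W_res ?m M (g n) W xi k * ((1/M) * (\<Sum>i<M. ?\<psi> (z k i)))) \<partial>resamp_stage ?m M X (g n) xi)"
    unfolding airpf_Wnext_def
    by (rule integral_xi_chain[where B=B])
      (assumption | rule xi gn nn W block_mean_measurable[OF \<psi>] block_mean_bound[OF M \<psi>_B] order_refl)+
  also have "\<dots> = (\<Sum>k<?m. W k * ((1/M) * (\<Sum>i<M. g n (xi k i) * ?\<psi> (xi k i))))"
    by (rule integral_resamp_stage[OF M xi nn \<psi> \<psi>_B])
  finally show ?thesis .
qed

text \<open>The denominator of the new estimator is the total weight, which is fixed given
  \<open>W\<close> and \<open>xi\<close> and equals the total after internal resampling; only the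
  numerator has to be integrated.\<close>

lemma integral_piN_airpf_step:
  assumes M: "1 \<le> M" and xi: "xi \<in> space (cfg_space (2^Sm) M X)" and gn: "g n \<in> borel_measurable X"
    and nn: "\<And>x. x \<in> space X \<Longrightarrow> 0 \<le> g n x" and W: "\<And>k. k < 2^Sm \<Longrightarrow> 0 \<le> W k"
    and K: "K (Suc n) \<in> X \<rightarrow>\<^sub>M prob_algebra X"
    and \<phi>: "\<phi> \<in> borel_measurable X" and B: "\<And>x. x \<in> space X \<Longrightarrow> \<bar>\<phi> x\<bar> \<le> B"
  shows "(\<integral>z. piN (2^Sm) M (airpf_Wnext (g n) Sm M \<tau> n W xi) z \<phi> \<partial>airpf_step X K g Sm M \<tau> n W xi)
    = piN (2^Sm) M W xi (\<lambda>x. g n x * (\<integral>y. \<phi> y \<partial>K (Suc n) x)) / piN (2^Sm) M W xi (g n)"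
proof -
  have S: "(\<Sum>k<2^Sm. airpf_Wnext (g n) Sm M \<tau> n W xi k) = (\<Sum>k<2^Sm. W k * ((1/M) * (\<Sum>i<M. g n (xi k i))))"
    unfolding airpf_Wnext_def by (simp only: sum_W_stage[OF order_refl]) (simp add: W_res_def)
  have T: "(\<Sum>k<2^Sm. W k) = 0 \<Longrightarrow> k < 2^Sm \<Longrightarrow> W k = 0" for k
    using W by (subst (asm) sum_nonneg_eq_0_iff) auto
  show ?thesis
  proof (cases "(\<Sum>k<2^Sm. W k) = 0")
    \<comment> \<open>All weights are zero, and both sides are 0 since
      \<open>x / 0 = 0\<close>.\<close>
    case True
    then show ?thesis
      using T by (simp add: piN_def S)
  next
    case False
    have "(\<integral>z. (\<Sum>k<2^Sm. airpf_Wnext (g n) Sm M \<tau> n W xi k * ((1/M) * (\<Sum>i<M. \<phi> (z k i)))) \<partial>airpf_step X K g Sm M \<tau> n W xi)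
        = (\<Sum>k<2^Sm. W k * ((1/M) * (\<Sum>i<M. g n (xi k i) * (\<integral>y. \<phi> y \<partial>K (Suc n) (xi k i)))))"
      by (rule integral_airpf_step[where B=B]) (assumption | rule assms)+
    \<comment> \<open>The old total weight cancels from the ratio on the right. If the new total
      weight is 0, both sides are again 0.\<close>
    with False show ?thesis
      unfolding piN_def integral_divide_zero S by simp
  qed
qed

text \<open>With positive total weight the estimator is a weighted mean of values bounded by
  \<open>B\<close>; with total weight 0 it equals 0, which is why \<open>0 \<le> B\<close> is
  assumed.\<close>

lemma abs_piN_le:
  assumes M: "1 \<le> M" and xi: "xi \<in> space (cfg_space m M X)" and W: "\<And>k. k < m \<Longrightarrow> 0 \<le> W k"
    and B: "\<And>x. x \<in> space X \<Longrightarrow> \<bar>\<phi> x\<bar> \<le> B" and "0 \<le> B"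
  shows "\<bar>piN m M W xi \<phi>\<bar> \<le> B"
proof -
  have "\<bar>\<Sum>k<m. W k * ((1/M) * (\<Sum>i<M. \<phi> (xi k i)))\<bar> \<le> (\<Sum>k<m. \<bar>W k\<bar> * B)"
    by (rule cfg_sum_bound[OF block_mean_bound[OF M B] xi])
  also have "\<dots> = (\<Sum>k<m. W k) * B"
    using W by (simp add: sum_distrib_right)
  finally show ?thesis
    using W \<open>0 \<le> B\<close> sum_nonneg[of "{..<m}" W]
    by (cases "(\<Sum>k<m. W k) = 0") (auto simp: piN_def abs_divide divide_le_eq mult.commute)
qed

lemma measurable_piN:
  assumes z: "z \<in> A \<rightarrow>\<^sub>M cfg_space m M X" and f: "f \<in> borel_measurable X"
    and w: "\<And>k. k < m \<Longrightarrow> (\<lambda>a. w a k) \<in> borel_measurable A"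
  shows "(\<lambda>a. piN m M (w a) (z a) f) \<in> borel_measurable A"
  unfolding piN_def
  by (intro borel_measurable_divide borel_measurable_sum borel_measurable_times borel_measurable_const w
      measurable_compose[OF measurable_particle[OF z] f]) auto

subsection \<open>The law of the history\<close>

text \<open>The weights at time \<open>n\<close> ignore the configurations from time
  \<open>n\<close> on, so extending or restricting a history does not change them.\<close>

lemma airpf_W_cong:
  "(\<And>p. p < n \<Longrightarrow> h p = h' p) \<Longrightarrow> airpf_W g Sm M \<tau> n h = airpf_W g Sm M \<tau> n h'"
  by (induction n) auto

lemma airpf_W_nonneg:
  assumes "\<And>p. p < n \<Longrightarrow> h p \<in> space (cfg_space (2^Sm) M X)"
    and nn: "\<And>p x. x \<in> space X \<Longrightarrow> 0 \<le> g p x" and "k < 2^Sm"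
  shows "0 \<le> airpf_W g Sm M \<tau> n h k"
  using assms(1,3)
proof (induction n arbitrary: k)
  case (Suc n)
  then show ?case
    by (auto simp: airpf_Wnext_def intro!: W_stage_nonneg W_res_nonneg[where X=X] nn)
qed simp

text \<open>The index set \<open>J\<close> is left open so that the weights can be used on history
  spaces of different lengths.\<close>

lemma measurable_airpf_W:
  assumes "{..<n} \<subseteq> J" and gm: "\<And>p. g p \<in> borel_measurable X" and "k < 2^Sm"
  shows "(\<lambda>h. airpf_W g Sm M \<tau> n h k) \<in> borel_measurable (PiM J (\<lambda>_. cfg_space (2^Sm) M X))"
  using assms(1,3)
proof (induction n arbitrary: k)
  case (Suc n)
  then have "n \<in> J" by auto
  have "(\<lambda>h. W_res (2^Sm) M (g n) (airpf_W g Sm M \<tau> n h) (h n) l)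
      \<in> borel_measurable (PiM J (\<lambda>_. cfg_space (2^Sm) M X))" if "l < 2^Sm" for l
    using Suc.prems \<open>n \<in> J\<close> that by (intro measurable_W_res[where X=X] gm Suc.IH) auto
  then show ?case
    using Suc.prems unfolding airpf_W.simps airpf_Wnext_def by (intro measurable_W_stage)
qed simp

definition airpf_kernel :: "'a measure \<Rightarrow> (nat \<Rightarrow> 'a \<Rightarrow> 'a measure) \<Rightarrow> (nat \<Rightarrow> 'a \<Rightarrow> real) \<Rightarrow> nat \<Rightarrow> nat \<Rightarrow> real
    \<Rightarrow> nat \<Rightarrow> (nat \<Rightarrow> 'a cfg) \<Rightarrow> (nat \<Rightarrow> 'a cfg) measure" where
  "airpf_kernel X K g Sm M \<tau> n h =
     distr (airpf_step X K g Sm M \<tau> n (airpf_W g Sm M \<tau> n h) (h n))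
       (hist_space X Sm M (Suc n)) (\<lambda>c. h(Suc n := c))"

lemma measurable_hist_step:
  assumes K: "K (Suc n) \<in> X \<rightarrow>\<^sub>M prob_algebra X" and gm: "\<And>p. g p \<in> borel_measurable X"
    and nn: "\<And>p x. x \<in> space X \<Longrightarrow> 0 \<le> g p x"
  shows "(\<lambda>h. airpf_step X K g Sm M \<tau> n (airpf_W g Sm M \<tau> n h) (h n))
    \<in> hist_space X Sm M n \<rightarrow>\<^sub>M prob_algebra (cfg_space (2^Sm) M X)"
  unfolding hist_space_def
  by (intro measurable_airpf_step measurable_airpf_W K gm)
    (auto simp: space_PiM intro!: nn airpf_W_nonneg[where X=X])

lemma measurable_hist_upd:
  "(\<lambda>(h, c). h(Suc n := c)) \<in> hist_space X Sm M n \<Otimes>\<^sub>M cfg_space (2^Sm) M X \<rightarrow>\<^sub>M hist_space X Sm M (Suc n)"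
  unfolding hist_space_def atMost_Suc
  by (rule measurable_add_dim)

lemma measurable_airpf_kernel:
  assumes "K (Suc n) \<in> X \<rightarrow>\<^sub>M prob_algebra X" "\<And>p. g p \<in> borel_measurable X"
    "\<And>p x. x \<in> space X \<Longrightarrow> 0 \<le> g p x"
  shows "airpf_kernel X K g Sm M \<tau> n \<in> hist_space X Sm M n \<rightarrow>\<^sub>M prob_algebra (hist_space X Sm M (Suc n))"
  unfolding airpf_kernel_def
  by (rule measurable_distr_prob_space2[OF measurable_hist_step[where K=K and n=n and g=g, OF assms] measurable_hist_upd])

lemma airpf_hist_in_prob_algebra:
  assumes pi0: "prob_space pi0" "sets pi0 = sets X"
    and K: "\<And>p. p \<ge> 1 \<Longrightarrow> K p \<in> X \<rightarrow>\<^sub>M prob_algebra X" and gm: "\<And>p. g p \<in> borel_measurable X"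
    and nn: "\<And>p x. x \<in> space X \<Longrightarrow> 0 \<le> g p x"
  shows "airpf_hist X pi0 K g Sm M \<tau> n \<in> space (prob_algebra (hist_space X Sm M n))"
proof (induction n)
  case 0
  let ?Q = "PiM {..<2^Sm} (\<lambda>k. PiM {..<M} (\<lambda>i. pi0)) :: 'a cfg measure"
  have sets: "sets ?Q = sets (cfg_space (2^Sm) M X)"
    unfolding cfg_space_def block_space_def by (intro sets_PiM_cong refl pi0)
  have "prob_space ?Q" by (intro prob_space_PiM pi0)
  moreover have "(\<lambda>c. \<lambda>p\<in>{..0}. c) \<in> ?Q \<rightarrow>\<^sub>M hist_space X Sm M 0"
    unfolding measurable_cong_sets[OF sets refl] hist_space_def
    by (intro measurable_restrict) simp
  ultimately show ?case
    by (simp add: space_prob_algebra prob_space.prob_space_distr)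
next
  case (Suc n)
  have "airpf_kernel X K g Sm M \<tau> n \<in> hist_space X Sm M n \<rightarrow>\<^sub>M prob_algebra (hist_space X Sm M (Suc n))"
    by (intro measurable_airpf_kernel K gm nn) auto
  from prob_space_bind'[OF Suc this] sets_bind'[OF Suc this] show ?case
    unfolding airpf_hist.simps airpf_kernel_def space_prob_algebra by simp
qed

text \<open>This is the tower formula for one time step: the newest configuration is integrated out
  given the earlier history.\<close>

lemma integral_airpf_hist_Suc:
  fixes u :: "(nat \<Rightarrow> 'a cfg) \<Rightarrow> real"
  assumes pi0: "prob_space pi0" "sets pi0 = sets X"
    and K: "\<And>p. p \<ge> 1 \<Longrightarrow> K p \<in> X \<rightarrow>\<^sub>M prob_algebra X" and gm: "\<And>p. g p \<in> borel_measurable X"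
    and nn: "\<And>p x. x \<in> space X \<Longrightarrow> 0 \<le> g p x"
    and u: "u \<in> borel_measurable (hist_space X Sm M (Suc n))"
    and B: "\<And>h. h \<in> space (hist_space X Sm M (Suc n)) \<Longrightarrow> \<bar>u h\<bar> \<le> B"
  shows "(\<integral>h. u h \<partial>airpf_hist X pi0 K g Sm M \<tau> (Suc n))
    = (\<integral>h. (\<integral>c. u (h(Suc n := c)) \<partial>airpf_step X K g Sm M \<tau> n (airpf_W g Sm M \<tau> n h) (h n))
        \<partial>airpf_hist X pi0 K g Sm M \<tau> n)"
proof -
  have H: "airpf_hist X pi0 K g Sm M \<tau> n \<in> space (prob_algebra (hist_space X Sm M n))"
    by (intro airpf_hist_in_prob_algebra pi0 K gm nn)
  have K': "K (Suc n) \<in> X \<rightarrow>\<^sub>M prob_algebra X" by (intro K) simp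
  have \<kappa>: "airpf_kernel X K g Sm M \<tau> n \<in> hist_space X Sm M n \<rightarrow>\<^sub>M prob_algebra (hist_space X Sm M (Suc n))"
    by (intro measurable_airpf_kernel K' gm nn)
  have "(\<integral>h. u h \<partial>airpf_hist X pi0 K g Sm M \<tau> (Suc n))
      = (\<integral>h. (\<integral>h'. u h' \<partial>airpf_kernel X K g Sm M \<tau> n h) \<partial>airpf_hist X pi0 K g Sm M \<tau> n)"
    unfolding airpf_hist.simps airpf_kernel_def[symmetric]
    by (rule integral_bind_prob_algebra[OF H \<kappa> u B])
  also have "\<dots> = (\<integral>h. (\<integral>c. u (h(Suc n := c)) \<partial>airpf_step X K g Sm M \<tau> n (airpf_W g Sm M \<tau> n h) (h n))
        \<partial>airpf_hist X pi0 K g Sm M \<tau> n)"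
  proof (rule Bochner_Integration.integral_cong[OF refl])
    fix h assume "h \<in> space (airpf_hist X pi0 K g Sm M \<tau> n)"
    then have h: "h \<in> space (hist_space X Sm M n)"
      using H by (auto simp: space_prob_algebra dest: sets_eq_imp_space_eq)
    let ?Q = "airpf_step X K g Sm M \<tau> n (airpf_W g Sm M \<tau> n h) (h n)"
    have Q: "sets ?Q = sets (cfg_space (2^Sm) M X)"
      using measurable_space[OF measurable_hist_step[where K=K and n=n and g=g, OF K' gm nn] h] by (simp add: space_prob_algebra)
    have "(\<lambda>c. h(Suc n := c)) \<in> ?Q \<rightarrow>\<^sub>M hist_space X Sm M (Suc n)"
      using measurable_Pair2[OF measurable_hist_upd h] by (simp add: measurable_cong_sets[OF Q refl])
    then show "(\<integral>h'. u h' \<partial>airpf_kernel X K g Sm M \<tau> n h) = (\<integral>c. u (h(Suc n := c)) \<partial>?Q)"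
      unfolding airpf_kernel_def by (rule integral_distr[OF _ u])
  qed
  finally show ?thesis .
qed

section \<open>Identification of the conditional expectation\<close>

theorem theorem1:
  fixes X pi0 :: "'a measure" and K :: "nat \<Rightarrow> 'a \<Rightarrow> 'a measure"
    and g :: "nat \<Rightarrow> 'a \<Rightarrow> real" and Sm M :: nat and \<tau> :: real
    and \<phi> :: "'a \<Rightarrow> real" and n :: nat
  assumes pi0: "prob_space pi0" "sets pi0 = sets X"
    and K: "\<And>p. p \<ge> 1 \<Longrightarrow> K p \<in> X \<rightarrow>\<^sub>M prob_algebra X"
    and g_meas: "\<And>p. g p \<in> borel_measurable X"
    and g_nonneg: "\<And>p x. x \<in> space X \<Longrightarrow> 0 \<le> g p x"
    and g_bdd: "\<And>p. \<exists>B. \<forall>x\<in>space X. g p x \<le> B"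
    and M: "M \<ge> 1"
    and tau: "0 < \<tau>" "\<tau> \<le> 1"
    and phi_meas: "\<phi> \<in> borel_measurable X"
    and phi_bdd: "\<exists>B. \<forall>x\<in>space X. \<bar>\<phi> x\<bar> \<le> B"
  defines "m \<equiv> (2::nat) ^ Sm"
    and "P \<equiv> airpf_hist X pi0 K g Sm M \<tau> (Suc n)"
  shows "prob_space P \<and>
    (AE h in P.
       real_cond_exp P (airpf_filt X Sm M P n)
         (\<lambda>h'. piN m M (airpf_W g Sm M \<tau> (Suc n) h') (h' (Suc n)) \<phi>) h
     = piN m M (airpf_W g Sm M \<tau> n h) (h n) (\<lambda>x. g n x * (\<integral>y. \<phi> y \<partial>K (Suc n) x))
       / piN m M (airpf_W g Sm M \<tau> n h) (h n) (g n))"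
proof -
  let ?H = "hist_space X Sm M n" and ?H' = "hist_space X Sm M (Suc n)"
  let ?C = "cfg_space m M X"
  let ?F = "airpf_filt X Sm M P n"
  let ?\<rho> = "\<lambda>h. restrict h {..n}"
  define f where "f h' = piN m M (airpf_W g Sm M \<tau> (Suc n) h') (h' (Suc n)) \<phi>" for h'
  define R where "R h = piN m M (airpf_W g Sm M \<tau> n h) (h n) (\<lambda>x. g n x * (\<integral>y. \<phi> y \<partial>K (Suc n) x))
       / piN m M (airpf_W g Sm M \<tau> n h) (h n) (g n)" for h
  define Q where "Q h = airpf_step X K g Sm M \<tau> n (airpf_W g Sm M \<tau> n h) (h n)" for h
  define Pn where "Pn = airpf_hist X pi0 K g Sm M \<tau> n"
  have K': "K (Suc n) \<in> X \<rightarrow>\<^sub>M prob_algebra X" by (intro K) simp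
  have hist: "airpf_hist X pi0 K g Sm M \<tau> j \<in> space (prob_algebra (hist_space X Sm M j))" for j
    by (intro airpf_hist_in_prob_algebra pi0 K g_meas g_nonneg)
  have P: "sets P = sets ?H'" "prob_space P"
    using hist[of "Suc n"] unfolding P_def space_prob_algebra by blast+
  have Pn: "sets Pn = sets ?H"
    using hist[of n] unfolding Pn_def space_prob_algebra by blast
  note spP = sets_eq_imp_space_eq[OF P(1)] and spPn = sets_eq_imp_space_eq[OF Pn]
  interpret P: prob_space P by (rule P(2))
  have Q: "sets (Q h) = sets ?C" "prob_space (Q h)" if "h \<in> space ?H" for h
    using measurable_space[OF measurable_hist_step[where K=K and n=n and g=g, OF K' g_meas g_nonneg] that]
    by (auto simp: space_prob_algebra Q_def m_def)
  obtain B0 where "\<forall>x\<in>space X. \<bar>\<phi> x\<bar> \<le> B0" using phi_bdd by auto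
  then have B: "\<bar>\<phi> x\<bar> \<le> \<bar>B0\<bar>" if "x \<in> space X" for x using that by fastforce
  \<comment> \<open>The absolute value guarantees a nonnegative bound, as \<open>abs_piN_le\<close>
    requires.\<close>
  define B where "B = \<bar>B0\<bar>"
  note B = B[folded B_def]
  have B0: "0 \<le> B" by (simp add: B_def)

  have f_meas: "f \<in> borel_measurable ?H'"
    unfolding f_def hist_space_def m_def
    by (intro measurable_piN[where X=X] measurable_airpf_W phi_meas g_meas) auto
  have f_bdd: "\<bar>f h\<bar> \<le> B" if "h \<in> space ?H'" for h
    using that unfolding f_def hist_space_def m_def
    by (intro abs_piN_le[where X=X] M airpf_W_nonneg[where X=X] B B0 g_nonneg) (auto simp: space_PiM)
  have R_meas: "R \<in> borel_measurable ?H"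
    unfolding R_def hist_space_def m_def
    by (intro borel_measurable_divide borel_measurable_times measurable_piN[where X=X] measurable_airpf_W
        integral_kernel_measurable K' phi_meas g_meas) auto
  \<comment> \<open>\<open>R\<close> depends on times up to \<open>n\<close> only. This gives both
    its measurability for the filtration and its invariance under changing the configuration at time
    \<open>Suc n\<close>.\<close>
  have R_cong: "R h = R h'" if "\<And>p. p \<le> n \<Longrightarrow> h p = h' p" for h h'
    using that airpf_W_cong[of n h h' g Sm M \<tau>] by (simp add: R_def)
  have f_upd: "f (h(Suc n := c)) = piN m M (airpf_Wnext (g n) Sm M \<tau> n (airpf_W g Sm M \<tau> n h) (h n)) c \<phi>" for h c
    using airpf_W_cong[of n "h(Suc n := c)" h g Sm M \<tau>] by (simp add: f_def)
  have R_upd: "R (h(Suc n := c)) = R h" for h c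
    by (rule R_cong) simp
  have Qf: "(\<integral>c. f (h(Suc n := c)) \<partial>Q h) = R h" if h: "h \<in> space ?H" for h
    unfolding f_upd R_def Q_def m_def
    by (rule integral_piN_airpf_step[where B=B])
      (use h M in \<open>auto simp: hist_space_def space_PiM intro!: K' g_meas g_nonneg phi_meas B airpf_W_nonneg[where X=X]\<close>)
  have upd_meas: "(\<lambda>c. h(Suc n := c)) \<in> Q h \<rightarrow>\<^sub>M ?H'" if h: "h \<in> space ?H" for h
    using measurable_Pair2[OF measurable_hist_upd h] by (simp add: measurable_cong_sets[OF Q(1)[OF h] refl] m_def)
  \<comment> \<open>The quotient is bounded because by \<open>Qf\<close> it is the mean of the
    bounded \<open>f\<close> under a probability measure; no lower bound on its denominator
    enters.\<close>
  have R_bdd: "\<bar>R h\<bar> \<le> B" if h: "h \<in> space ?H" for h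
    unfolding Qf[OF h, symmetric] using upd_meas[OF h]
    by (intro prob_space.abs_expectation_le[OF Q(2)[OF h]] measurable_compose[OF upd_meas[OF h] f_meas] f_bdd)
      (auto dest: measurable_space)

  have \<rho>: "?\<rho> \<in> P \<rightarrow>\<^sub>M ?H"
    unfolding measurable_cong_sets[OF P(1) refl] hist_space_def by (intro measurable_restrict_subset) auto
  have \<rho>_sp: "?\<rho> \<in> space P \<rightarrow> space ?H"
    using measurable_space[OF \<rho>] by auto
  have sets_F: "sets ?F = {?\<rho> -` A \<inter> space P | A. A \<in> sets ?H}"
    unfolding airpf_filt_def by (rule sets_vimage_algebra2[OF \<rho>_sp])
  have sub: "subalgebra P ?F"
    unfolding subalgebra_def sets_F using measurable_sets[OF \<rho>] by (auto simp: airpf_filt_def)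
  interpret F: finite_measure_subalgebra P ?F
    by unfold_locales (rule sub)
  have R\<rho>: "R h = R (?\<rho> h)" for h by (rule R_cong) simp
  have R_F: "R \<in> borel_measurable ?F"
    using measurable_compose[OF measurable_vimage_algebra1[OF \<rho>_sp] R_meas]
    unfolding R\<rho>[symmetric] airpf_filt_def .
  have R_P: "R \<in> borel_measurable P"
    by (rule measurable_from_subalg[OF sub R_F])
  have f_P: "f \<in> borel_measurable P"
    using f_meas by (simp add: measurable_cong_sets[OF P(1) refl])
  have R_bdd': "\<bar>R h\<bar> \<le> B" if "h \<in> space P" for h
    unfolding R\<rho>[of h] using \<rho>_sp that by (intro R_bdd) auto

  \<comment> \<open>An event of the filtration is decided by the history up to time
    \<open>n\<close>, so its indicator leaves the inner integral over the next
    configuration.\<close>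
  have int: "(\<integral>h. indicator A (?\<rho> h) * u h \<partial>P) = (\<integral>h. indicator A h * (\<integral>c. u (h(Suc n := c)) \<partial>Q h) \<partial>Pn)"
    if A: "A \<in> sets ?H" and u: "u \<in> borel_measurable P" and ub: "\<And>h. h \<in> space P \<Longrightarrow> \<bar>u h\<bar> \<le> B" for A u
  proof -
    have "(\<lambda>h. indicator A (?\<rho> h) * u h) \<in> borel_measurable P"
      by (intro borel_measurable_times u measurable_compose[OF \<rho> borel_measurable_indicator[OF A]])
    then have "(\<lambda>h. indicator A (?\<rho> h) * u h) \<in> borel_measurable ?H'"
      by (simp add: measurable_cong_sets[OF P(1) refl])
    moreover have "\<bar>indicator A (?\<rho> h) * u h\<bar> \<le> B" if "h \<in> space ?H'" for h
      using ub[of h] that B0 by (auto simp: spP indicator_def)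
    ultimately have "(\<integral>h. indicator A (?\<rho> h) * u h \<partial>P)
        = (\<integral>h. (\<integral>c. indicator A (?\<rho> (h(Suc n := c))) * u (h(Suc n := c)) \<partial>Q h) \<partial>Pn)"
      unfolding P_def Pn_def Q_def by (intro integral_airpf_hist_Suc[where B=B] pi0 K g_meas g_nonneg) auto
    also have "\<dots> = (\<integral>h. indicator A h * (\<integral>c. u (h(Suc n := c)) \<partial>Q h) \<partial>Pn)"
    proof (rule Bochner_Integration.integral_cong[OF refl])
      fix h assume "h \<in> space Pn"
      \<comment> \<open>A history in \<open>space Pn\<close> is \<open>undefined\<close> after time
        \<open>n\<close>, so restricting the updated function recovers \<open>h\<close>
        exactly.\<close>
      then have "?\<rho> (h(Suc n := c)) = h" for c
        by (auto simp: spPn hist_space_def space_PiM PiE_def extensional_def restrict_def fun_eq_iff)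
      then show "(\<integral>c. indicator A (?\<rho> (h(Suc n := c))) * u (h(Suc n := c)) \<partial>Q h)
          = indicator A h * (\<integral>c. u (h(Suc n := c)) \<partial>Q h)"
        by simp
    qed
    finally show ?thesis .
  qed

  have "AE h in P. real_cond_exp P ?F f h = R h"
  \<comment> \<open>It remains to compare the integrals of \<open>f\<close> and \<open>R\<close>
    over every event of the filtration.\<close>
  proof (rule F.real_cond_exp_charact)
    show "integrable P f"
      using f_bdd f_P by (intro P.integrable_const_bound[of _ B]) (auto simp: spP)
    show "integrable P R"
      using R_bdd' R_P by (intro P.integrable_const_bound[of _ B]) auto
    show "R \<in> borel_measurable ?F" by (rule R_F)
    fix A' assume "A' \<in> sets ?F"
    then obtain A where A: "A \<in> sets ?H" and A': "A' = ?\<rho> -` A \<inter> space P"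
      unfolding sets_F by auto
    have set: "(\<integral>h\<in>A'. u h \<partial>P) = (\<integral>h. indicator A (?\<rho> h) * u h \<partial>P)" for u :: "_ \<Rightarrow> real"
      unfolding set_lebesgue_integral_def A'
      by (intro Bochner_Integration.integral_cong refl) (auto simp: indicator_def)
    have "(\<integral>h\<in>A'. f h \<partial>P) = (\<integral>h. indicator A h * (\<integral>c. f (h(Suc n := c)) \<partial>Q h) \<partial>Pn)"
      unfolding set using f_bdd by (intro int A f_P) (auto simp: spP)
    \<comment> \<open>Both inner integrals equal \<open>R h\<close>: the first by \<open>Qf\<close>,
      the second because its integrand is constant in \<open>c\<close> and \<open>Q h\<close> has
      mass one.\<close>
    also have "\<dots> = (\<integral>h. indicator A h * (\<integral>c. R (h(Suc n := c)) \<partial>Q h) \<partial>Pn)"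
      using Q(2) by (intro Bochner_Integration.integral_cong refl)
        (simp add: spPn Qf R_upd prob_space.prob_space)
    also have "\<dots> = (\<integral>h\<in>A'. R h \<partial>P)"
      unfolding set by (intro int[symmetric] A R_P R_bdd')
    finally show "(\<integral>h\<in>A'. f h \<partial>P) = (\<integral>h\<in>A'. R h \<partial>P)" .
  qed
  then show ?thesis
    using P(2) unfolding f_def R_def by simp
qed

end
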